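(* Let $g,d,n$ be positive integers, let $A\in SM_d(\mathbb{R})^g$ be a minimal defining tuple for the free spectrahedron $\mathcal{D}_A$, and let $X\in\mathcal{D}_A(n)$. Write $k_{A,X}:=\dim\ker L_A(X)$. Then: (1) If $X$ is an Arveson extreme point of $\mathcal{D}_A$, then $gn\le d\,k_{A,X}$. (2) If $\mathcal{D}_A$ is a free polytope and $X$ is an Arveson extreme point of $\mathcal{D}_A$, then $gn\le k_{A,X}$. (3) Suppose $A$ is unitarily equivalent to $\bigoplus_{j=1}^{\ell}A^j$, where $A^j\in SM_{d_j}(\mathbb{R})^g$ for each $j$, and set $k^j_{A,X}:=\dim\ker L_{A^j}(X)$ for $j=1,\dots,\ell$. If $X$ is an Arveson extreme point of $\mathcal{D}_A$, then $$gn\le\sum_{j=1}^{\ell}d_j\,k^j_{A,X}.$$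
   Context: $SM_n(\mathbb{R})^g$ denotes the set of $g$-tuples $X=(X_1,\dots,X_g)$ of real symmetric $n\times n$ matrices. For $A\in SM_d(\mathbb{R})^g$ and $X\in SM_n(\mathbb{R})^g$, set $L_A(X):=I_{dn}-A_1\otimes X_1-\dots-A_g\otimes X_g$ (Kronecker products). The free spectrahedron of $A$ at level $n$ is $\mathcal{D}_A(n):=\{X\in SM_n(\mathbb{R})^g: L_A(X)\succeq0\}$, and $\mathcal{D}_A:=\bigcup_{n\ge1}\mathcal{D}_A(n)$. A tuple $A$ is called a defining tuple for $\mathcal{D}_A$. A defining tuple $A\in SM_d(\mathbb{R})^g$ is minimal if every $B\in SM_{d'}(\mathbb{R})^g$ with $\mathcal{D}_B=\mathcal{D}_A$ satisfies $d\le d'$. Tuples $X,Y\in SM_n(\mathbb{R})^g$ are unitarily equivalent if there is a real orthogonal matrix $U$ with $U^TX_iU=Y_i$ for all $i$. Direct sums of tuples are taken entrywise. $\mathcal{D}_A$ is a free polytope if a minimal defining tuple for it is simultaneously diagonalizable, i.e. unitarily equivalent to a tuple of diagonal matrices. $X\in\mathcal{D}_A(n)$ is an Arveson extreme point of $\mathcal{D}_A$ if, whenever $m\ge 1$, $\beta$ is a $g$-tuple of real $n\times m$ matrices and $\gamma\in SM_m(\mathbb{R})^g$ are such that $\begin{pmatrix}X&\beta\\ \beta^T&\gamma\end{pmatrix}\in\mathcal{D}_A$ (the block tuple with $i$-th entry $\begin{pmatrix}X_i&\beta_i\\ \beta_i^T&\gamma_i\end{pmatrix}$), one has $\beta=0$.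 *)

theory Defs
  imports "Jordan_Normal_Form.Matrix_Kernel"
begin

text \<open>
  A tuple of matrices is a list.  The matrix sizes vary inside the notions below (in the levels of a
  free spectrahedron, in minimality, in dilations), so they are numbers, not types.
\<close>

definition sym_tuples :: "nat \<Rightarrow> nat \<Rightarrow> real mat list set" where
  "sym_tuples g n =
     {X. length X = g \<and> (\<forall>M\<in>set X. M \<in> carrier_mat n n \<and> transpose_mat M = M)}"

definition kronecker_mat :: "real mat \<Rightarrow> real mat \<Rightarrow> real mat" where
  "kronecker_mat A B =
     mat (dim_row A * dim_row B) (dim_col A * dim_col B)
       (\<lambda>(i, j). A $$ (i div dim_row B, j div dim_col B) * B $$ (i mod dim_row B, j mod dim_col B))"

text \<open>
  The left fold is literally \<open>I - A\<^sub>1 \<otimes> X\<^sub>1 - \<dots> - A\<^sub>g \<otimes> X\<^sub>g\<close>, where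
  \<open>d\<close> and \<open>n\<close> are the sizes of the matrices in \<open>A\<close> and \<open>X\<close>.
\<close>

definition lin_pencil :: "nat \<Rightarrow> nat \<Rightarrow> real mat list \<Rightarrow> real mat list \<Rightarrow> real mat" where
  "lin_pencil d n A X = foldl (-) (1\<^sub>m (d * n)) (map2 kronecker_mat A X)"

definition psd_mat :: "real mat \<Rightarrow> bool" where
  "psd_mat M \<longleftrightarrow> square_mat M \<and> transpose_mat M = M \<and>
     (\<forall>v\<in>carrier_vec (dim_row M). v \<bullet> (M *\<^sub>v v) \<ge> 0)"

definition spectrahedron_level ::
    "nat \<Rightarrow> nat \<Rightarrow> real mat list \<Rightarrow> nat \<Rightarrow> real mat list set" where
  "spectrahedron_level g d A n = {X \<in> sym_tuples g n. psd_mat (lin_pencil d n A X)}"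

definition free_spectrahedron :: "nat \<Rightarrow> nat \<Rightarrow> real mat list \<Rightarrow> real mat list set" where
  "free_spectrahedron g d A = (\<Union>n\<in>{1..}. spectrahedron_level g d A n)"

definition minimal_defining_tuple :: "nat \<Rightarrow> nat \<Rightarrow> real mat list \<Rightarrow> bool" where
  "minimal_defining_tuple g d A \<longleftrightarrow> A \<in> sym_tuples g d \<and>
     (\<forall>d' B. d' \<ge> 1 \<longrightarrow> B \<in> sym_tuples g d' \<longrightarrow>
        free_spectrahedron g d' B = free_spectrahedron g d A \<longrightarrow> d \<le> d')"

text \<open>
  The library predicate \<^const>\<open>orthogonal_mat\<close> only asks for nonzero, pairwise orthogonal
  columns, without normalisation; hence the explicit equation for \<open>U\<close>.
\<close>

definition unitarily_equivalent :: "nat \<Rightarrow> real mat list \<Rightarrow> real mat list \<Rightarrow> bool" where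
  "unitarily_equivalent n X Y \<longleftrightarrow>
     (\<exists>U\<in>carrier_mat n n. transpose_mat U * U = 1\<^sub>m n \<and>
        map (\<lambda>M. transpose_mat U * M * U) X = Y)"

definition tuple_direct_sum :: "nat \<Rightarrow> real mat list list \<Rightarrow> real mat list" where
  "tuple_direct_sum g As = map (\<lambda>i. diag_block_mat (map (\<lambda>B. B ! i) As)) [0..<g]"

definition simultaneously_diagonalizable :: "nat \<Rightarrow> real mat list \<Rightarrow> bool" where
  "simultaneously_diagonalizable d A \<longleftrightarrow>
     (\<exists>Y. unitarily_equivalent d A Y \<and> (\<forall>M\<in>set Y. diagonal_mat M))"

definition free_polytope :: "nat \<Rightarrow> real mat list set \<Rightarrow> bool" where
  "free_polytope g D \<longleftrightarrow>
     (\<exists>d\<ge>1. \<exists>B. minimal_defining_tuple g d B \<and> free_spectrahedron g d B = D \<and>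
        simultaneously_diagonalizable d B)"

definition block_tuple ::
    "nat \<Rightarrow> real mat list \<Rightarrow> real mat list \<Rightarrow> real mat list \<Rightarrow> real mat list" where
  "block_tuple g X \<beta> \<gamma> =
     map (\<lambda>i. four_block_mat (X ! i) (\<beta> ! i) (transpose_mat (\<beta> ! i)) (\<gamma> ! i)) [0..<g]"

definition arveson_extreme_point ::
    "nat \<Rightarrow> nat \<Rightarrow> real mat list \<Rightarrow> nat \<Rightarrow> real mat list \<Rightarrow> bool" where
  "arveson_extreme_point g d A n X \<longleftrightarrow> X \<in> spectrahedron_level g d A n \<and>
     (\<forall>m \<beta> \<gamma>. m \<ge> 1 \<longrightarrow> length \<beta> = g \<longrightarrow> set \<beta> \<subseteq> carrier_mat n m \<longrightarrow> \<gamma> \<in> sym_tuples g m \<longrightarrow>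
        block_tuple g X \<beta> \<gamma> \<in> free_spectrahedron g d A \<longrightarrow> (\<forall>M\<in>set \<beta>. M = 0\<^sub>m n m))"

end

theory Submission
  imports Defs
begin

text \<open>
  The bounds count equations against unknowns. Try to dilate \<open>X\<close> by a single extra row and column:
  the block tuple with border \<open>\<beta> = (\<beta>\<^sub>1, \<dots>, \<beta>\<^sub>g)\<close>, where each \<open>\<beta>\<^sub>k\<close> is a vector of length \<open>n\<close>,
  and corner zero. Up to a permutation of coordinates its pencil is
  \<open>[[L, -N\<^sup>T], [-N, I]]\<close> with \<open>L = L\<^sub>A(X)\<close> and \<open>N = \<Sum>\<^sub>k A\<^sub>k \<otimes> \<beta>\<^sub>k\<^sup>T\<close>, so it is positive semidefinite as
  soon as \<open>L \<ge> N\<^sup>T N\<close>. After scaling \<open>\<beta>\<close> by a small positive factor this holds whenever the kernel of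
  \<open>L\<close> is contained in the kernel of \<open>N\<close> (\<open>psd_mat_dominates\<close>). An Arveson extreme point has no such dilation with
  \<open>\<beta> \<noteq> 0\<close>. The requirement that \<open>N\<close> vanish on a basis of \<open>ker L\<close> is a homogeneous linear system of
  \<open>d * dim (ker L)\<close> equations in the \<open>g * n\<close> entries of \<open>\<beta>\<close>, so extremality forces
  \<open>g * n \<le> d * dim (ker L)\<close>. If \<open>A\<close> is unitarily equivalent to a direct sum, positivity can be tested
  summand by summand, and the same count with the equations of all summands gives the third bound
  (\<open>arveson_extreme_point_kernel_bound\<close>), of which the first is the case of one summand.

  If \<open>d = 1\<close>, the second bound coincides with the first. For a free polytope with \<open>d \<ge> 2\<close> the
  point is that the given minimal tuple \<open>A\<close> is itself diagonalizable
  (\<open>minimal_free_polytope_diagonal\<close>); then the summands have size one and their kernels add up to the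
  kernel of \<open>L\<^sub>A(X)\<close>. By hypothesis some minimal tuple, necessarily of the same size \<open>d\<close>, is
  diagonalizable, hence the free spectrahedron is cut out by \<open>d\<close> half-spaces with normals
  \<open>b\<^sub>1, \<dots>, b\<^sub>d\<close>, and by minimality none of them is redundant. Each normal is a joint eigenvalue of \<open>A\<close>: choose
  a point \<open>x\<close> of level one in the relative interior of the \<open>j\<close>-th facet. There \<open>L\<^sub>A(x)\<close> is singular,
  with kernel vector \<open>v\<close>, say. Moving \<open>x\<close> slightly along the facet in both directions keeps the pencil
  positive semidefinite, so its quadratic form at \<open>v\<close>, being affine, stays zero, and \<open>v\<close> stays in the
  kernel. Comparing the kernel equations gives \<open>A\<^sub>k v = b\<^sub>j\<^sub>k v\<close> for all \<open>k\<close>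
  (\<open>facet_normal_joint_eigenvalue\<close>). The \<open>d\<close> joint eigenvalues are distinct, so their eigenvectors
  form an orthogonal basis that diagonalizes \<open>A\<close>.
\<close>

section \<open>Positive semidefinite matrices and linear systems\<close>

lemma scalar_prod_self_nonneg: "(v :: real vec) \<bullet> v \<ge> 0"
  unfolding scalar_prod_def by (intro sum_nonneg) simp

lemma scalar_prod_self_eq_0_iff:
  assumes "(v :: real vec) \<in> carrier_vec n"
  shows "v \<bullet> v = 0 \<longleftrightarrow> v = 0\<^sub>v n"
proof
  assume "v \<bullet> v = 0"
  then have "(\<Sum>i<n. v $ i * v $ i) = 0"
    using assms by (simp add: scalar_prod_def atLeast0LessThan)
  then have "\<forall>i<n. v $ i = 0"
    by (subst (asm) sum_nonneg_eq_0_iff) auto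
  then show "v = 0\<^sub>v n" using assms by (intro eq_vecI) auto
qed (use assms in simp)

lemma symmetric_mat_scalar_prod:
  assumes "(M :: real mat) \<in> carrier_mat n n" "M\<^sup>T = M" "u \<in> carrier_vec n" "v \<in> carrier_vec n"
  shows "u \<bullet> (M *\<^sub>v v) = (M *\<^sub>v u) \<bullet> v"
  using transpose_vec_mult_scalar[OF assms(1,4,3)] assms(2) by simp

lemma quadratic_form_add:
  assumes "(M :: real mat) \<in> carrier_mat n n" "M\<^sup>T = M" "u \<in> carrier_vec n" "v \<in> carrier_vec n"
  shows "(u + t \<cdot>\<^sub>v v) \<bullet> (M *\<^sub>v (u + t \<cdot>\<^sub>v v))
    = u \<bullet> (M *\<^sub>v u) + 2 * t * (u \<bullet> (M *\<^sub>v v)) + t\<^sup>2 * (v \<bullet> (M *\<^sub>v v))"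
proof -
  have c: "M *\<^sub>v u \<in> carrier_vec n" "M *\<^sub>v v \<in> carrier_vec n" using assms by auto
  have e: "M *\<^sub>v (u + t \<cdot>\<^sub>v v) = M *\<^sub>v u + t \<cdot>\<^sub>v (M *\<^sub>v v)"
    using assms by (simp add: mult_add_distrib_mat_vec[of _ n n] mult_mat_vec[of _ n n])
  have s: "v \<bullet> (M *\<^sub>v u) = u \<bullet> (M *\<^sub>v v)"
    using symmetric_mat_scalar_prod[OF assms(1,2,4,3)] comm_scalar_prod[of "M *\<^sub>v v" n u] c assms by simp
  show ?thesis unfolding e using assms c
    by (simp add: add_scalar_prod_distrib[of _ n] scalar_prod_add_distrib[of _ n] s power2_eq_square algebra_simps)
qed

lemma psd_mat_nonneg:
  assumes "psd_mat M" "M \<in> carrier_mat n n" "v \<in> carrier_vec n"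
  shows "v \<bullet> (M *\<^sub>v v) \<ge> 0"
  using assms by (simp add: psd_mat_def)

text \<open>
  The quadratic polynomial \<open>t \<mapsto> (u + t v) \<bullet> M (u + t v)\<close> is nonnegative, so its discriminant is
  nonpositive.
\<close>

lemma psd_mat_Cauchy_Schwarz:
  assumes "psd_mat M" "M \<in> carrier_mat n n" "u \<in> carrier_vec n" "v \<in> carrier_vec n"
  shows "(u \<bullet> (M *\<^sub>v v))\<^sup>2 \<le> (u \<bullet> (M *\<^sub>v u)) * (v \<bullet> (M *\<^sub>v v))"
proof -
  define a b c where "a = u \<bullet> (M *\<^sub>v u)" and "b = u \<bullet> (M *\<^sub>v v)" and "c = v \<bullet> (M *\<^sub>v v)"
  have sym: "M\<^sup>T = M" using assms by (simp add: psd_mat_def)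
  have q: "a + 2 * t * b + t\<^sup>2 * c \<ge> 0" for t
    using quadratic_form_add[OF assms(2) sym assms(3,4), of t] assms
    by (auto simp: psd_mat_def a_def b_def c_def dest!: bspec[of _ _ "u + t \<cdot>\<^sub>v v"])
  have c0: "c \<ge> 0" using assms by (auto simp: psd_mat_def c_def)
  have "b\<^sup>2 \<le> a * c"
  proof (cases "c = 0")
    case True
    have "b = 0"
    proof (rule ccontr)
      assume b: "b \<noteq> 0"
      then have "2 * (- (a + 1) / (2 * b)) * b = - (a + 1)" by simp
      then show False using q[of "- (a + 1) / (2 * b)"] True by simp
    qed
    then show ?thesis using True by simp
  next
    case False
    with c0 have "c > 0" by simp
    then have "a - b\<^sup>2 / c \<ge> 0" using q[of "- b / c"] by (simp add: power2_eq_square field_simps)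
    then show ?thesis using \<open>c > 0\<close> by (simp add: field_simps)
  qed
  then show ?thesis by (simp add: a_def b_def c_def)
qed

lemma psd_mat_kernelI:
  assumes "psd_mat M" "M \<in> carrier_mat n n" "v \<in> carrier_vec n" "v \<bullet> (M *\<^sub>v v) = 0"
  shows "M *\<^sub>v v = 0\<^sub>v n"
proof -
  have "M *\<^sub>v v \<in> carrier_vec n" using assms by simp
  moreover from psd_mat_Cauchy_Schwarz[OF assms(1,2) this assms(3)]
  have "(M *\<^sub>v v) \<bullet> (M *\<^sub>v v) = 0" using assms(4) by simp
  ultimately show ?thesis using scalar_prod_self_eq_0_iff by blast
qed

text \<open>
  The kernel of a matrix is the image of a matrix with as many columns as the kernel has dimensions;
  this turns the abstract dimension into a number of vectors that can be counted.
\<close>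

lemma kernel_basis_matrix:
  assumes M: "(M :: real mat) \<in> carrier_mat m n"
  obtains Z where "Z \<in> carrier_mat n (kernel_dim M)"
    and "\<And>s. s < kernel_dim M \<Longrightarrow> M *\<^sub>v col Z s = 0\<^sub>v m"
    and "\<And>v. v \<in> carrier_vec n \<Longrightarrow> M *\<^sub>v v = 0\<^sub>v m \<Longrightarrow>
      \<exists>c \<in> carrier_vec (kernel_dim M). v = Z *\<^sub>v c"
proof -
  interpret kernel m n M by unfold_locales (rule M)
  obtain B where B: "finite B" "basis B" using kernel_basis_exists[OF M] by blast
  have BK: "B \<subseteq> mat_kernel M" using B(2) by (auto simp: Ker.basis_def)
  define k where "k = kernel_dim M"
  have card: "card B = k" unfolding k_def kernel_dim using Ker.dim_basis[OF B] by (rule sym)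
  obtain bs where bs: "set bs = B" "distinct bs" using finite_distinct_list[OF B(1)] by blast
  have len: "length bs = k" using bs card distinct_card[of bs] by argo
  have kerB: "x \<in> carrier_vec n" "M *\<^sub>v x = 0\<^sub>v m" if "x \<in> B" for x
    using BK mat_kernel[OF M] that by blast+
  define Z where "Z = mat_of_cols n bs"
  have Z: "Z \<in> carrier_mat n k" using mat_of_cols_carrier(1)[of n bs] unfolding Z_def len .
  have cols: "col Z s = bs ! s" "bs ! s \<in> B" if "s < k" for s
  proof -
    show "bs ! s \<in> B" using nth_mem[of s bs] that unfolding len bs(1) .
    then show "col Z s = bs ! s" using that len kerB unfolding Z_def by (intro col_mat_of_cols) argo+
  qed
  have gen: "\<exists>c \<in> carrier_vec k. v = Z *\<^sub>v c"
    if v: "v \<in> carrier_vec n" "M *\<^sub>v v = 0\<^sub>v m" for v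
  proof -
    have "v \<in> mat_kernel M" by (rule mat_kernelI[OF M v])
    then have "v \<in> span B" using B(2) unfolding Ker.basis_def by blast
    then obtain a where a: "v = lincomb a B"
      using Ker.finite_in_span[OF B(1) BK] by blast
    define c where "c = vec k (\<lambda>s. a (bs ! s))"
    have comb: "v $ i = (\<Sum>s<k. a (bs ! s) * bs ! s $ i)" if i: "i < n" for i
    proof -
      have "v $ i = (\<Sum>x\<in>set bs. a x * x $ i)" unfolding a lincomb_index[OF i BK] bs(1) ..
      also have "\<dots> = (\<Sum>x\<leftarrow>bs. a x * x $ i)" by (rule sum_list_distinct_conv_sum_set[OF bs(2), symmetric])
      also have "\<dots> = (\<Sum>s<k. a (bs ! s) * bs ! s $ i)"
        unfolding sum_list_sum_nth len[symmetric] by (simp add: atLeast0LessThan)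
      finally show ?thesis .
    qed
    have "v = Z *\<^sub>v c"
    proof (rule eq_vecI)
      fix i assume "i < dim_vec (Z *\<^sub>v c)"
      then have i: "i < n" using Z by (metis carrier_matD(1) dim_mult_mat_vec)
      have "(Z *\<^sub>v c) $ i = (\<Sum>s<k. a (bs ! s) * bs ! s $ i)"
        using i len unfolding Z_def c_def mat_of_cols_def scalar_prod_def mult_mat_vec_def
        by (auto simp: atLeast0LessThan mult.commute intro!: sum.cong)
      then show "v $ i = (Z *\<^sub>v c) $ i" using comb[OF i] by argo
    next
      show "dim_vec v = dim_vec (Z *\<^sub>v c)" using v(1) Z by (metis carrier_matD(1) carrier_vecD dim_mult_mat_vec)
    qed
    moreover have "c \<in> carrier_vec k" unfolding c_def by (rule vec_carrier)
    ultimately show ?thesis by blast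
  qed
  show thesis
  proof (rule that[folded k_def, OF Z _ gen])
    show "M *\<^sub>v col Z s = 0\<^sub>v m" if "s < k" for s
      unfolding cols(1)[OF that] by (rule kerB(2)[OF cols(2)[OF that]])
  qed
qed

text \<open>
  The Fredholm alternative. If the columns of \<open>Z\<close> span the kernel of \<open>M\<close>, then \<open>M + Z Z\<^sup>T\<close> is
  injective, hence invertible, and a preimage \<open>x\<close> of \<open>r\<close> gives \<open>r = M x + z\<close> with \<open>z\<close> in the kernel.
  Both \<open>r\<close> and \<open>M x\<close> are orthogonal to \<open>z\<close>, so \<open>z = 0\<close>.
\<close>

lemma orthogonal_to_kernel_in_range:
  assumes psd: "psd_mat M" and M: "M \<in> carrier_mat n n" and r: "r \<in> carrier_vec n"
    and orth: "\<And>v. v \<in> carrier_vec n \<Longrightarrow> M *\<^sub>v v = 0\<^sub>v n \<Longrightarrow> r \<bullet> v = 0"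
  obtains x where "x \<in> carrier_vec n" "M *\<^sub>v x = r"
proof -
  have sym: "M\<^sup>T = M" using psd by (simp add: psd_mat_def)
  obtain Z where Z: "Z \<in> carrier_mat n (kernel_dim M)"
    and MZ: "\<And>s. s < kernel_dim M \<Longrightarrow> M *\<^sub>v col Z s = 0\<^sub>v n"
    and gen: "\<And>v. v \<in> carrier_vec n \<Longrightarrow> M *\<^sub>v v = 0\<^sub>v n \<Longrightarrow>
      \<exists>c \<in> carrier_vec (kernel_dim M). v = Z *\<^sub>v c"
    using kernel_basis_matrix[OF M] by blast
  define k where "k = kernel_dim M"
  note Z = Z[folded k_def] and MZ = MZ[folded k_def] and gen = gen[folded k_def]
  have MZ0: "M * Z = 0\<^sub>m n k"
  proof (rule eq_matI)
    fix i j assume ij: "i < dim_row (0\<^sub>m n k :: real mat)" "j < dim_col (0\<^sub>m n k :: real mat)"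
    then have "(M * Z) $$ (i, j) = (M *\<^sub>v col Z j) $ i" using M Z by simp
    then show "(M * Z) $$ (i, j) = 0\<^sub>m n k $$ (i, j)" using MZ[of j] ij by simp
  qed (use M Z in auto)
  define P where "P = M + Z * Z\<^sup>T"
  have P: "P \<in> carrier_mat n n" using M Z by (simp add: P_def)
  have ZT: "Z\<^sup>T \<in> carrier_mat k n" using Z by simp
  have Pv: "P *\<^sub>v v = M *\<^sub>v v + Z *\<^sub>v (Z\<^sup>T *\<^sub>v v)" if "v \<in> carrier_vec n" for v
    using that M Z ZT by (simp add: P_def add_mult_distrib_mat_vec[of _ n n])
  have inj: "v = 0\<^sub>v n" if v: "v \<in> carrier_vec n" and P0: "P *\<^sub>v v = 0\<^sub>v n" for v
  proof -
    define w where "w = Z\<^sup>T *\<^sub>v v"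
    have w: "w \<in> carrier_vec k" using ZT v by (simp add: w_def)
    have Zw: "v \<bullet> (Z *\<^sub>v w) = w \<bullet> w"
      using transpose_vec_mult_scalar[OF Z w v] by (simp add: w_def)
    have "v \<bullet> (M *\<^sub>v v) + w \<bullet> w = v \<bullet> (P *\<^sub>v v)"
      unfolding Pv[OF v] w_def[symmetric] Zw[symmetric]
      using v M Z w by (subst scalar_prod_add_distrib[of _ n]) auto
    also have "\<dots> = 0" using P0 v by simp
    finally have "v \<bullet> (M *\<^sub>v v) = 0" "w \<bullet> w = 0"
      using psd v M scalar_prod_self_nonneg[of w] by (auto simp: psd_mat_def dest!: bspec[of _ _ v])
    then have "M *\<^sub>v v = 0\<^sub>v n" and w0: "w = 0\<^sub>v k"
      using psd_mat_kernelI[OF psd M v] scalar_prod_self_eq_0_iff[OF w] by auto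
    then obtain c where c: "c \<in> carrier_vec k" "v = Z *\<^sub>v c" using gen v by blast
    have "v \<bullet> v = w \<bullet> c" using transpose_vec_mult_scalar[OF Z c(1) v] c by (simp add: w_def)
    also have "\<dots> = 0" using w0 c by simp
    finally show ?thesis using scalar_prod_self_eq_0_iff[OF v] by simp
  qed
  then have "det P \<noteq> 0" using det_0_iff_vec_prod_zero[OF P] by blast
  from det_non_zero_imp_unit[OF P this, of "()"] obtain Q
    where Q: "Q \<in> carrier_mat n n" "P * Q = 1\<^sub>m n" by (auto simp: Units_def ring_mat_def)
  define x where "x = Q *\<^sub>v r"
  have x: "x \<in> carrier_vec n" using Q r by (simp add: x_def)
  have Px: "P *\<^sub>v x = r" unfolding x_def using assoc_mult_mat_vec[OF P Q(1) r] Q r by simp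
  define z where "z = Z *\<^sub>v (Z\<^sup>T *\<^sub>v x)"
  have z: "z \<in> carrier_vec n" using Z x by (simp add: z_def)
  have Mz: "M *\<^sub>v z = 0\<^sub>v n"
  proof -
    have y: "Z\<^sup>T *\<^sub>v x \<in> carrier_vec k" using ZT x by simp
    have "M *\<^sub>v z = 0\<^sub>m n k *\<^sub>v (Z\<^sup>T *\<^sub>v x)"
      unfolding z_def assoc_mult_mat_vec[OF M Z y, symmetric] MZ0 ..
    also have "\<dots> = 0\<^sub>v n" using y Z by (intro eq_vecI) auto
    finally show ?thesis .
  qed
  have Mx: "M *\<^sub>v x \<in> carrier_vec n" using M x by simp
  have rsum: "r = M *\<^sub>v x + z" using Pv[OF x] Px by (simp add: z_def)
  have "0 = r \<bullet> z" using orth[OF z Mz] by simp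
  also have "\<dots> = (M *\<^sub>v x) \<bullet> z + z \<bullet> z" unfolding rsum
    using add_scalar_prod_distrib[OF Mx z z] .
  also have "(M *\<^sub>v x) \<bullet> z = 0" using symmetric_mat_scalar_prod[OF M sym x z] Mz x by simp
  finally have "z = 0\<^sub>v n" using scalar_prod_self_eq_0_iff[OF z] by simp
  then have "M *\<^sub>v x = r" using rsum Mx by simp
  then show thesis using that x by blast
qed

text \<open>
  Write \<open>r = M x\<close>; then the claim is the Cauchy-Schwarz inequality with \<open>C = x \<bullet> M x\<close>.
\<close>

lemma psd_mat_dominates_row:
  assumes psd: "psd_mat M" and M: "M \<in> carrier_mat n n" and r: "r \<in> carrier_vec n"
    and orth: "\<And>v. v \<in> carrier_vec n \<Longrightarrow> M *\<^sub>v v = 0\<^sub>v n \<Longrightarrow> r \<bullet> v = 0"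
  obtains C where "C \<ge> 0" "\<And>u. u \<in> carrier_vec n \<Longrightarrow> (r \<bullet> u)\<^sup>2 \<le> C * (u \<bullet> (M *\<^sub>v u))"
proof -
  obtain x where x: "x \<in> carrier_vec n" "M *\<^sub>v x = r"
    using orthogonal_to_kernel_in_range[OF psd M r orth] by blast
  have sym: "M\<^sup>T = M" using psd by (simp add: psd_mat_def)
  show thesis
  proof (rule that)
    show "x \<bullet> (M *\<^sub>v x) \<ge> 0" using psd x(1) M by (simp add: psd_mat_def)
    fix u :: "real vec" assume u: "u \<in> carrier_vec n"
    then have "r \<bullet> u = x \<bullet> (M *\<^sub>v u)" using symmetric_mat_scalar_prod[OF M sym x(1) u] x(2) by simp
    then show "(r \<bullet> u)\<^sup>2 \<le> x \<bullet> (M *\<^sub>v x) * (u \<bullet> (M *\<^sub>v u))"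
      using psd_mat_Cauchy_Schwarz[OF psd M x(1) u] by simp
  qed
qed

text \<open>
  A form \<open>N\<^sup>T N\<close> that vanishes on the kernel of a positive semidefinite \<open>M\<close> can be subtracted from it
  after scaling. Both the dilation argument and the singularity of pencils at boundary points rest
  on this.
\<close>

lemma psd_mat_dominates:
  assumes psd: "psd_mat M" and M: "M \<in> carrier_mat n n" and N: "N \<in> carrier_mat k n"
    and ker: "\<And>v. v \<in> carrier_vec n \<Longrightarrow> M *\<^sub>v v = 0\<^sub>v n \<Longrightarrow> N *\<^sub>v v = 0\<^sub>v k"
  obtains C where "C \<ge> 0"
    "\<And>u. u \<in> carrier_vec n \<Longrightarrow> (N *\<^sub>v u) \<bullet> (N *\<^sub>v u) \<le> C * (u \<bullet> (M *\<^sub>v u))"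
proof -
  have "\<exists>C\<ge>0. \<forall>u\<in>carrier_vec n. (row N i \<bullet> u)\<^sup>2 \<le> C * (u \<bullet> (M *\<^sub>v u))" if i: "i < k" for i
  proof -
    have "row N i \<bullet> v = 0" if "v \<in> carrier_vec n" "M *\<^sub>v v = 0\<^sub>v n" for v
      using ker[OF that] i N by (metis index_mult_mat_vec index_zero_vec(1) carrier_matD(1))
    then show ?thesis using psd_mat_dominates_row[OF psd M, of "row N i"] N i by (metis row_carrier_vec)
  qed
  then obtain C where C: "\<And>i. i < k \<Longrightarrow> C i \<ge> 0"
    "\<And>i u. i < k \<Longrightarrow> u \<in> carrier_vec n \<Longrightarrow> (row N i \<bullet> u)\<^sup>2 \<le> C i * (u \<bullet> (M *\<^sub>v u))" by metis
  show thesis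
  proof (rule that)
    show "(\<Sum>i<k. C i) \<ge> 0" using C(1) by (intro sum_nonneg) simp
    fix u :: "real vec" assume u: "u \<in> carrier_vec n"
    have "(N *\<^sub>v u) \<bullet> (N *\<^sub>v u) = (\<Sum>i<k. (row N i \<bullet> u)\<^sup>2)"
      using N by (simp add: scalar_prod_def[of "N *\<^sub>v u" "N *\<^sub>v u"] atLeast0LessThan power2_eq_square)
    also have "\<dots> \<le> (\<Sum>i<k. C i * (u \<bullet> (M *\<^sub>v u)))" using C(2) u by (intro sum_mono) simp
    finally show "(N *\<^sub>v u) \<bullet> (N *\<^sub>v u) \<le> (\<Sum>i<k. C i) * (u \<bullet> (M *\<^sub>v u))"
      by (simp add: sum_distrib_right)
  qed
qed

text \<open>
  Padding with zero rows makes the system square and singular.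
\<close>

lemma homogeneous_system_nontrivial_solution:
  assumes rs: "set rs \<subseteq> carrier_vec p" and len: "length rs < p"
  obtains v :: "real vec" where "v \<in> carrier_vec p" "v \<noteq> 0\<^sub>v p" "\<And>r. r \<in> set rs \<Longrightarrow> r \<bullet> v = 0"
proof -
  define K where "K = mat p p (\<lambda>(i, j). if i < length rs then rs ! i $ j else 0)"
  have K: "K \<in> carrier_mat p p" by (simp add: K_def)
  have "K\<^sup>T *\<^sub>v unit_vec p (length rs) = 0\<^sub>v p"
    using len by (intro eq_vecI) (auto simp: K_def)
  moreover have "unit_vec p (length rs) \<noteq> (0\<^sub>v p :: real vec)" using len by simp
  ultimately have "det K = 0"
    using det_0_iff_vec_prod_zero[of "K\<^sup>T" p] det_transpose[OF K] K by (metis transpose_carrier_mat unit_vec_carrier)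
  then obtain v where v: "v \<in> carrier_vec p" "v \<noteq> 0\<^sub>v p" "K *\<^sub>v v = 0\<^sub>v p"
    using det_0_iff_vec_prod_zero[OF K] by blast
  show thesis
  proof (rule that[OF v(1,2)])
    fix r assume "r \<in> set rs"
    then obtain i where i: "i < length rs" "r = rs ! i" by (auto simp: in_set_conv_nth)
    then have "r \<in> carrier_vec p" using rs by auto
    then have "row K i = r" using i len by (intro eq_vecI) (auto simp: K_def)
    then have "r \<bullet> v = (K *\<^sub>v v) $ i" using i len K by simp
    then show "r \<bullet> v = 0" using v i len by simp
  qed
qed

section \<open>Entries of linear pencils\<close>

lemma sym_tuplesD:
  assumes "A \<in> sym_tuples g d"
  shows "length A = g" "k < g \<Longrightarrow> A ! k \<in> carrier_mat d d" "k < g \<Longrightarrow> (A ! k)\<^sup>T = A ! k"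
    "set A \<subseteq> carrier_mat d d"
  using assms nth_mem[of k A] by (auto simp: sym_tuples_def)

lemma sym_tuples_mapI:
  assumes "\<And>k. k < g \<Longrightarrow> f k \<in> carrier_mat d d" "\<And>k. k < g \<Longrightarrow> (f k)\<^sup>T = f k"
  shows "map f [0..<g] \<in> sym_tuples g d"
  using assms by (auto simp: sym_tuples_def)

lemma foldl_minus_carrier:
  assumes "C \<in> carrier_mat n m" "set Ks \<subseteq> carrier_mat n m"
  shows "foldl (-) C Ks \<in> carrier_mat n m"
  using assms
proof (induction Ks arbitrary: C)
  case (Cons K Ks)
  then show ?case using minus_carrier_mat[of K n m C] by auto
qed simp

lemma foldl_minus_index:
  fixes C :: "real mat"
  assumes "C \<in> carrier_mat n m" "set Ks \<subseteq> carrier_mat n m" "i < n" "j < m"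
  shows "foldl (-) C Ks $$ (i, j) = C $$ (i, j) - (\<Sum>K\<leftarrow>Ks. K $$ (i, j))"
  using assms
proof (induction Ks arbitrary: C)
  case (Cons K Ks)
  then have "foldl (-) (C - K) Ks $$ (i, j) = (C - K) $$ (i, j) - (\<Sum>K\<leftarrow>Ks. K $$ (i, j))"
    using minus_carrier_mat[of K n m C] by auto
  moreover have "K \<in> carrier_mat n m" using Cons.prems by simp
  then have "(C - K) $$ (i, j) = C $$ (i, j) - K $$ (i, j)" using Cons.prems(3,4) by simp
  ultimately show ?case by simp
qed simp

lemma kronecker_mat_carrier [simp]:
  "A \<in> carrier_mat a b \<Longrightarrow> B \<in> carrier_mat p q \<Longrightarrow> kronecker_mat A B \<in> carrier_mat (a * p) (b * q)"
  by (auto simp: kronecker_mat_def)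

lemma index_kronecker_mat:
  assumes "A \<in> carrier_mat a b" "B \<in> carrier_mat p q" "i < a * p" "j < b * q"
  shows "kronecker_mat A B $$ (i, j) = A $$ (i div p, j div q) * B $$ (i mod p, j mod q)"
  using assms by (auto simp: kronecker_mat_def)

lemma div_mod_less:
  fixes i a n :: nat
  assumes "i < a * n"
  shows "i div n < a" "i mod n < n"
proof -
  show "i div n < a" using assms by (simp add: less_mult_imp_div_less)
  show "i mod n < n" using assms by (cases n) auto
qed

lemma map2_kronecker_subset:
  assumes "set A \<subseteq> carrier_mat d d" "set X \<subseteq> carrier_mat n n"
  shows "set (map2 kronecker_mat A X) \<subseteq> carrier_mat (d * n) (d * n)"
proof
  fix K assume "K \<in> set (map2 kronecker_mat A X)"
  then obtain M Y where "(M, Y) \<in> set (zip A X)" and K: "K = kronecker_mat M Y" by auto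
  then have "M \<in> carrier_mat d d" "Y \<in> carrier_mat n n"
    using assms set_zip_leftD[of M Y A X] set_zip_rightD[of M Y A X] by blast+
  then show "K \<in> carrier_mat (d * n) (d * n)" unfolding K by (rule kronecker_mat_carrier)
qed

lemma lin_pencil_carrier:
  assumes "set A \<subseteq> carrier_mat d d" "set X \<subseteq> carrier_mat n n"
  shows "lin_pencil d n A X \<in> carrier_mat (d * n) (d * n)"
  unfolding lin_pencil_def using map2_kronecker_subset[OF assms] by (intro foldl_minus_carrier) auto

lemma lin_pencil_sym_carrier:
  assumes "A \<in> sym_tuples g d" "X \<in> sym_tuples g n"
  shows "lin_pencil d n A X \<in> carrier_mat (d * n) (d * n)"
  by (rule lin_pencil_carrier[OF sym_tuplesD(4)[OF assms(1)] sym_tuplesD(4)[OF assms(2)]])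

text \<open>
  Coordinates of \<open>\<real>\<^bsup>dn\<^esup>\<close> are pairs: the index \<open>i\<close> stands for \<open>(i div n, i mod n)\<close>, the first
  component belonging to \<open>A\<close> and the second to \<open>X\<close>.
\<close>

lemma index_lin_pencil:
  assumes A: "A \<in> sym_tuples g d" and X: "X \<in> sym_tuples g n" and ij: "i < d * n" "j < d * n"
  shows "lin_pencil d n A X $$ (i, j) = (if i = j then 1 else 0) -
    (\<Sum>k<g. A ! k $$ (i div n, j div n) * X ! k $$ (i mod n, j mod n))"
proof -
  have "lin_pencil d n A X $$ (i, j) =
      1\<^sub>m (d * n) $$ (i, j) - (\<Sum>K\<leftarrow>map2 kronecker_mat A X. K $$ (i, j))"
    unfolding lin_pencil_def
    by (rule foldl_minus_index[OF one_carrier_mat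
          map2_kronecker_subset[OF sym_tuplesD(4)[OF A] sym_tuplesD(4)[OF X]] ij])
  also have "(\<Sum>K\<leftarrow>map2 kronecker_mat A X. K $$ (i, j)) = (\<Sum>k<g. kronecker_mat (A ! k) (X ! k) $$ (i, j))"
    using sym_tuplesD(1)[OF A] sym_tuplesD(1)[OF X]
    by (simp add: sum_list_sum_nth atLeast0LessThan)
  also have "\<dots> = (\<Sum>k<g. A ! k $$ (i div n, j div n) * X ! k $$ (i mod n, j mod n))"
    using index_kronecker_mat[OF sym_tuplesD(2)[OF A] sym_tuplesD(2)[OF X] ij] by (intro sum.cong) auto
  finally show ?thesis using ij by simp
qed

lemma sym_tuples_index_commute:
  assumes "A \<in> sym_tuples g d" "k < g" "p < d" "q < d"
  shows "A ! k $$ (p, q) = A ! k $$ (q, p)"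
  using sym_tuplesD(2,3)[OF assms(1,2)] assms(3,4) by (metis carrier_matD index_transpose_mat(1))

lemma transpose_lin_pencil:
  assumes A: "A \<in> sym_tuples g d" and X: "X \<in> sym_tuples g n"
  shows "(lin_pencil d n A X)\<^sup>T = lin_pencil d n A X"
proof -
  have L: "lin_pencil d n A X \<in> carrier_mat (d * n) (d * n)"
    by (rule lin_pencil_sym_carrier[OF A X])
  show ?thesis
  proof (rule eq_matI)
    fix i j assume "i < dim_row (lin_pencil d n A X)" "j < dim_col (lin_pencil d n A X)"
    then have ij: "i < d * n" "j < d * n" using L by auto
    have "A ! k $$ (j div n, i div n) = A ! k $$ (i div n, j div n)"
         "X ! k $$ (j mod n, i mod n) = X ! k $$ (i mod n, j mod n)" if "k < g" for k
      using sym_tuples_index_commute[OF A that] sym_tuples_index_commute[OF X that]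
        div_mod_less[OF ij(1)] div_mod_less[OF ij(2)] by auto
    then show "(lin_pencil d n A X)\<^sup>T $$ (i, j) = lin_pencil d n A X $$ (i, j)"
      using L ij by (simp add: index_lin_pencil[OF A X])
  qed (use L in auto)
qed

section \<open>Pencils of direct sums\<close>

lemma psd_mat_four_block:
  assumes B: "B \<in> carrier_mat a a" and D: "D \<in> carrier_mat b b"
  shows "psd_mat (four_block_mat B (0\<^sub>m a b) (0\<^sub>m b a) D) \<longleftrightarrow> psd_mat B \<and> psd_mat D"
    (is "psd_mat ?F \<longleftrightarrow> _")
proof -
  have F: "?F \<in> carrier_mat (a + b) (a + b)" using B D by simp
  have T: "?F\<^sup>T = four_block_mat (B\<^sup>T) (0\<^sub>m a b) (0\<^sub>m b a) (D\<^sup>T)"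
    using transpose_four_block_mat[OF B _ _ D] by simp
  have q: "(u @\<^sub>v w) \<bullet> (?F *\<^sub>v (u @\<^sub>v w)) = u \<bullet> (B *\<^sub>v u) + w \<bullet> (D *\<^sub>v w)"
    if "u \<in> carrier_vec a" "w \<in> carrier_vec b" for u w :: "real vec"
  proof -
    have z: "0\<^sub>m a b *\<^sub>v w = 0\<^sub>v a" "0\<^sub>m b a *\<^sub>v u = 0\<^sub>v b" using that by auto
    have "B *\<^sub>v u \<in> carrier_vec a" "D *\<^sub>v w \<in> carrier_vec b" using B D that by auto
    then show ?thesis using that B D z
      by (simp add: four_block_mat_mult_vec[OF B _ _ D] scalar_prod_append[of _ a _ b])
  qed
  have symB: "B\<^sup>T = B \<and> D\<^sup>T = D" if sym: "?F\<^sup>T = ?F"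
  proof -
    have e: "?F $$ (i, j) = ?F $$ (j, i)" if "i < a + b" "j < a + b" for i j
      using that F sym by (metis carrier_matD index_transpose_mat(1))
    have "B $$ (j, i) = B $$ (i, j)" if "i < a" "j < a" for i j
      using e[of i j] that B D by simp
    moreover have "D $$ (j, i) = D $$ (i, j)" if "i < b" "j < b" for i j
      using e[of "a + i" "a + j"] that B D by simp
    ultimately show ?thesis using B D by (auto intro!: eq_matI)
  qed
  have "(\<forall>v \<in> carrier_vec (a + b). v \<bullet> (?F *\<^sub>v v) \<ge> 0) \<longleftrightarrow>
      (\<forall>u \<in> carrier_vec a. u \<bullet> (B *\<^sub>v u) \<ge> 0) \<and> (\<forall>w \<in> carrier_vec b. w \<bullet> (D *\<^sub>v w) \<ge> 0)"
  proof (intro iffI conjI ballI)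
    fix u :: "real vec" assume u: "u \<in> carrier_vec a" and h: "\<forall>v \<in> carrier_vec (a + b). v \<bullet> (?F *\<^sub>v v) \<ge> 0"
    show "u \<bullet> (B *\<^sub>v u) \<ge> 0" using bspec[OF h, of "u @\<^sub>v 0\<^sub>v b"] q[OF u, of "0\<^sub>v b"] u D by simp
  next
    fix w :: "real vec" assume w: "w \<in> carrier_vec b" and h: "\<forall>v \<in> carrier_vec (a + b). v \<bullet> (?F *\<^sub>v v) \<ge> 0"
    show "w \<bullet> (D *\<^sub>v w) \<ge> 0" using bspec[OF h, of "0\<^sub>v a @\<^sub>v w"] q[OF _ w, of "0\<^sub>v a"] w B by simp
  next
    fix v :: "real vec" assume v: "v \<in> carrier_vec (a + b)"
      and h: "(\<forall>u \<in> carrier_vec a. u \<bullet> (B *\<^sub>v u) \<ge> 0) \<and> (\<forall>w \<in> carrier_vec b. w \<bullet> (D *\<^sub>v w) \<ge> 0)"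
    have "v = vec_first v a @\<^sub>v vec_last v b" using vec_first_last_append[OF v] by simp
    then show "v \<bullet> (?F *\<^sub>v v) \<ge> 0"
      using q[of "vec_first v a" "vec_last v b"] h by (metis add_nonneg_nonneg vec_first_carrier vec_last_carrier)
  qed
  then show ?thesis using symB F B D T by (auto simp: psd_mat_def)
qed

lemma diag_block_mat_carrier:
  assumes "\<forall>M\<in>set Ms. square_mat M"
  shows "diag_block_mat Ms \<in> carrier_mat (\<Sum>M\<leftarrow>Ms. dim_row M) (\<Sum>M\<leftarrow>Ms. dim_row M)"
proof -
  have "map dim_col Ms = map dim_row Ms" using assms by auto
  then show ?thesis by (metis carrier_matI dim_diag_block_mat)
qed

lemma psd_mat_diag_block_mat:
  assumes "\<forall>M\<in>set Ms. square_mat M"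
  shows "psd_mat (diag_block_mat Ms) \<longleftrightarrow> (\<forall>M\<in>set Ms. psd_mat M)"
  using assms
proof (induction Ms)
  case Nil
  then show ?case by (auto simp: psd_mat_def scalar_prod_def)
next
  case (Cons M Ms)
  define s where "s = (\<Sum>M\<leftarrow>Ms. dim_row M)"
  have D: "diag_block_mat Ms \<in> carrier_mat s s"
    using diag_block_mat_carrier[of Ms] Cons.prems by (simp add: s_def)
  have M: "M \<in> carrier_mat (dim_row M) (dim_row M)" using Cons.prems by auto
  have "diag_block_mat (M # Ms) =
      four_block_mat M (0\<^sub>m (dim_row M) s) (0\<^sub>m s (dim_row M)) (diag_block_mat Ms)"
    unfolding diag_block_mat.simps Let_def carrier_matD[OF D] carrier_matD(2)[OF M] ..
  then show ?case using psd_mat_four_block[OF M D] Cons by simp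
qed

lemma kernel_dim_diag_block_mat:
  fixes Ms :: "real mat list"
  assumes "\<forall>M\<in>set Ms. square_mat M"
  shows "kernel_dim (diag_block_mat Ms) = (\<Sum>M\<leftarrow>Ms. kernel_dim M)"
  using assms
proof (induction Ms)
  case Nil
  have "kernel_dim (1\<^sub>m 0 :: real mat) = 0"
    using kernel_one_mat(1)[of 0] by (simp add: kernel_dim_def)
  moreover have "(1\<^sub>m 0 :: real mat) = 0\<^sub>m 0 0" by (intro eq_matI) auto
  ultimately show ?case by simp
next
  case (Cons M Ms)
  define s where "s = (\<Sum>M\<leftarrow>Ms. dim_row M)"
  have D: "diag_block_mat Ms \<in> carrier_mat s s"
    using diag_block_mat_carrier[of Ms] Cons.prems by (simp add: s_def)
  have M: "M \<in> carrier_mat (dim_row M) (dim_row M)" using Cons.prems by auto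
  have e: "diag_block_mat (M # Ms) =
      four_block_mat M (0\<^sub>m (dim_row M) s) (0\<^sub>m s (dim_row M)) (diag_block_mat Ms)"
    unfolding diag_block_mat.simps Let_def carrier_matD[OF D] carrier_matD(2)[OF M] ..
  have "kernel_dim (diag_block_mat (M # Ms)) = kernel_dim M + kernel_dim (diag_block_mat Ms)"
    using kernel_four_block_0_mat[OF e M D] carrier_matD(2)[OF M] carrier_matD(2)[OF D]
    unfolding kernel_dim_def e index_mat_four_block by simp
  then show ?case using Cons by simp
qed

text \<open>
  With the coefficients of the defining tuple as left Kronecker factors, a block decomposition of
  them is a block decomposition of the pencil without any permutation of coordinates.
\<close>

lemma lin_pencil_four_block:
  assumes A: "A \<in> sym_tuples g a" and B: "B \<in> sym_tuples g b" and X: "X \<in> sym_tuples g n"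
    and F: "map (\<lambda>i. four_block_mat (A ! i) (0\<^sub>m a b) (0\<^sub>m b a) (B ! i)) [0..<g] \<in> sym_tuples g (a + b)"
      (is "?F \<in> _")
  shows "lin_pencil (a + b) n ?F X = four_block_mat (lin_pencil a n A X)
    (0\<^sub>m (a * n) (b * n)) (0\<^sub>m (b * n) (a * n)) (lin_pencil b n B X)" (is "_ = ?R")
proof (rule eq_matI)
  have LA: "lin_pencil a n A X \<in> carrier_mat (a * n) (a * n)"
   and LB: "lin_pencil b n B X \<in> carrier_mat (b * n) (b * n)"
   and LF: "lin_pencil (a + b) n ?F X \<in> carrier_mat ((a + b) * n) ((a + b) * n)"
    by (rule lin_pencil_sym_carrier[OF A X] lin_pencil_sym_carrier[OF B X] lin_pencil_sym_carrier[OF F X])+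
  then show "dim_row (lin_pencil (a + b) n ?F X) = dim_row ?R"
    "dim_col (lin_pencil (a + b) n ?F X) = dim_col ?R" by (auto simp: algebra_simps)
  fix i j assume "i < dim_row ?R" "j < dim_col ?R"
  then have ij: "i < (a + b) * n" "j < (a + b) * n" using LA LB by (auto simp: algebra_simps)
  have split: "(i < a * n \<longleftrightarrow> i div n < a)" "i \<ge> a * n \<Longrightarrow> (i - a * n) div n = i div n - a"
    "i \<ge> a * n \<Longrightarrow> (i - a * n) mod n = i mod n" if "i < (a + b) * n" for i
  proof -
    have n: "n > 0" using that by (cases n) auto
    show "(i < a * n \<longleftrightarrow> i div n < a)" using n by (simp add: div_less_iff_less_mult)
    assume "i \<ge> a * n"
    then obtain c where "i = a * n + c" by (metis le_Suc_ex)
    then show "(i - a * n) div n = i div n - a" "(i - a * n) mod n = i mod n" using n by auto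
  qed
  have ent: "lin_pencil (a + b) n ?F X $$ (i, j) = (if i = j then 1 else 0) -
      (\<Sum>k<g. four_block_mat (A ! k) (0\<^sub>m a b) (0\<^sub>m b a) (B ! k) $$ (i div n, j div n)
          * X ! k $$ (i mod n, j mod n))"
    unfolding index_lin_pencil[OF F X ij] by (intro arg_cong2[of _ _ _ _ minus] sum.cong) auto
  have dm: "i div n < a + b" "j div n < a + b" using div_mod_less ij by auto
  have blk: "four_block_mat (A ! k) (0\<^sub>m a b) (0\<^sub>m b a) (B ! k) $$ (i div n, j div n) =
      (if i < a * n then if j < a * n then A ! k $$ (i div n, j div n) else 0
       else if j < a * n then 0 else B ! k $$ (i div n - a, j div n - a))" if "k < g" for k
    using sym_tuplesD(2)[OF A that] sym_tuplesD(2)[OF B that] dm split(1)[OF ij(1)] split(1)[OF ij(2)]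
    by auto
  have R: "?R $$ (i, j) = (if i < a * n then if j < a * n then lin_pencil a n A X $$ (i, j) else 0
       else if j < a * n then 0 else lin_pencil b n B X $$ (i - a * n, j - a * n))"
    using LA LB ij by (auto simp: algebra_simps)
  have bn: "i - a * n < b * n" "j - a * n < b * n" if "i \<ge> a * n" "j \<ge> a * n"
    using ij that by (auto simp: algebra_simps)
  show "lin_pencil (a + b) n ?F X $$ (i, j) = ?R $$ (i, j)"
    unfolding ent R using split(2,3)[OF ij(1)] split(2,3)[OF ij(2)] bn
    by (auto simp: blk index_lin_pencil[OF A X] index_lin_pencil[OF B X])
qed

lemma tuple_direct_sum_Cons:
  assumes "B \<in> sym_tuples g b" "tuple_direct_sum g As \<in> sym_tuples g s"
  shows "tuple_direct_sum g (B # As) =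
    map (\<lambda>i. four_block_mat (B ! i) (0\<^sub>m b s) (0\<^sub>m s b) (tuple_direct_sum g As ! i)) [0..<g]"
proof -
  have "diag_block_mat (map (\<lambda>B. B ! i) (B # As)) =
      four_block_mat (B ! i) (0\<^sub>m b s) (0\<^sub>m s b) (tuple_direct_sum g As ! i)" if "i < g" for i
    using sym_tuplesD(2)[OF assms(1) that] sym_tuplesD(2)[OF assms(2) that] that
    by (auto simp: Let_def tuple_direct_sum_def)
  then show ?thesis by (auto simp: tuple_direct_sum_def)
qed

lemma tuple_direct_sum_sym:
  assumes "\<And>j. j \<in> set js \<Longrightarrow> Aj j \<in> sym_tuples g (dj j)"
  shows "tuple_direct_sum g (map Aj js) \<in> sym_tuples g (\<Sum>j\<leftarrow>js. dj j)"
  using assms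
proof (induction js)
  case Nil
  have "(0\<^sub>m 0 0)\<^sup>T = (0\<^sub>m 0 0 :: real mat)" by (intro eq_matI) auto
  then show ?case by (auto simp: tuple_direct_sum_def sym_tuples_def)
next
  case (Cons j js)
  define S s where "S = tuple_direct_sum g (map Aj js)" and "s = (\<Sum>j\<leftarrow>js. dj j)"
  have S: "S \<in> sym_tuples g s" and A: "Aj j \<in> sym_tuples g (dj j)" using Cons by (auto simp: S_def s_def)
  have "map (\<lambda>i. four_block_mat (Aj j ! i) (0\<^sub>m (dj j) s) (0\<^sub>m s (dj j)) (S ! i)) [0..<g]
      \<in> sym_tuples g (dj j + s)"
    using sym_tuplesD(2,3)[OF A] sym_tuplesD(2,3)[OF S]
    by (intro sym_tuples_mapI four_block_carrier_mat) (auto simp: transpose_four_block_mat[of _ "dj j" "dj j" _ s _ s])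
  then show ?case using tuple_direct_sum_Cons[OF A S[unfolded S_def]] by (simp add: S_def s_def)
qed

lemma lin_pencil_direct_sum:
  assumes "\<And>j. j \<in> set js \<Longrightarrow> Aj j \<in> sym_tuples g (dj j)" and X: "X \<in> sym_tuples g n"
  shows "lin_pencil (\<Sum>j\<leftarrow>js. dj j) n (tuple_direct_sum g (map Aj js)) X =
    diag_block_mat (map (\<lambda>j. lin_pencil (dj j) n (Aj j) X) js)"
  using assms(1)
proof (induction js)
  case Nil
  have "tuple_direct_sum g (map Aj []) \<in> sym_tuples g 0" using tuple_direct_sum_sym[of "[]" Aj g dj] by simp
  then have "lin_pencil 0 n (tuple_direct_sum g (map Aj [])) X \<in> carrier_mat 0 0"
    using lin_pencil_sym_carrier[OF _ X] by fastforce
  then show ?case by (intro eq_matI) auto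
next
  case (Cons j js)
  define S s where "S = tuple_direct_sum g (map Aj js)" and "s = (\<Sum>j\<leftarrow>js. dj j)"
  have S: "S \<in> sym_tuples g s" unfolding S_def s_def by (rule tuple_direct_sum_sym) (use Cons in auto)
  have A: "Aj j \<in> sym_tuples g (dj j)" using Cons by auto
  note e = tuple_direct_sum_Cons[OF A S[unfolded S_def], folded S_def]
  have F: "tuple_direct_sum g (Aj j # map Aj js) \<in> sym_tuples g (dj j + s)"
    using tuple_direct_sum_sym[of "j # js" Aj g dj] Cons.prems by (simp add: s_def)
  have IH: "lin_pencil s n S X = diag_block_mat (map (\<lambda>j. lin_pencil (dj j) n (Aj j) X) js)"
    unfolding s_def S_def using Cons by simp
  have LA: "lin_pencil (dj j) n (Aj j) X \<in> carrier_mat (dj j * n) (dj j * n)"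
    and LS: "lin_pencil s n S X \<in> carrier_mat (s * n) (s * n)"
    by (rule lin_pencil_sym_carrier[OF A X] lin_pencil_sym_carrier[OF S X])+
  have "lin_pencil (\<Sum>j\<leftarrow>j # js. dj j) n (tuple_direct_sum g (map Aj (j # js))) X
      = four_block_mat (lin_pencil (dj j) n (Aj j) X)
          (0\<^sub>m (dj j * n) (s * n)) (0\<^sub>m (s * n) (dj j * n)) (lin_pencil s n S X)"
    using lin_pencil_four_block[OF A S X F[unfolded e]] by (simp add: e s_def)
  also have "\<dots> = diag_block_mat (map (\<lambda>j. lin_pencil (dj j) n (Aj j) X) (j # js))"
    using LA LS unfolding IH by (auto simp: Let_def)
  finally show ?case .
qed

lemma psd_lin_pencil_direct_sum:
  assumes "\<And>j. j \<in> set js \<Longrightarrow> Aj j \<in> sym_tuples g (dj j)" and X: "X \<in> sym_tuples g n"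
  shows "psd_mat (lin_pencil (\<Sum>j\<leftarrow>js. dj j) n (tuple_direct_sum g (map Aj js)) X) \<longleftrightarrow>
    (\<forall>j\<in>set js. psd_mat (lin_pencil (dj j) n (Aj j) X))"
proof -
  have "\<forall>M\<in>set (map (\<lambda>j. lin_pencil (dj j) n (Aj j) X) js). square_mat M"
    using lin_pencil_sym_carrier[OF assms] by fastforce
  from psd_mat_diag_block_mat[OF this] show ?thesis
    using lin_pencil_direct_sum[of js Aj g dj X n, OF assms] by simp
qed

lemma kernel_dim_lin_pencil_direct_sum:
  assumes "\<And>j. j \<in> set js \<Longrightarrow> Aj j \<in> sym_tuples g (dj j)" and X: "X \<in> sym_tuples g n"
  shows "kernel_dim (lin_pencil (\<Sum>j\<leftarrow>js. dj j) n (tuple_direct_sum g (map Aj js)) X) =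
    (\<Sum>j\<leftarrow>js. kernel_dim (lin_pencil (dj j) n (Aj j) X))"
proof -
  have "\<forall>M\<in>set (map (\<lambda>j. lin_pencil (dj j) n (Aj j) X) js). square_mat M"
    using lin_pencil_sym_carrier[OF assms] by fastforce
  from kernel_dim_diag_block_mat[OF this] show ?thesis
    using lin_pencil_direct_sum[of js Aj g dj X n, OF assms] by (simp add: comp_def)
qed

section \<open>Pencils of unitarily equivalent tuples\<close>

lemma sum_div_mod:
  fixes f :: "nat \<Rightarrow> nat \<Rightarrow> real"
  shows "(\<Sum>k<b * q. f (k div q) (k mod q)) = (\<Sum>x<b. \<Sum>y<q. f x y)"
proof (cases "q = 0")
  case False
  have "(\<Sum>k<b * q. f (k div q) (k mod q)) = (\<Sum>x<b. \<Sum>k=x*q..<x*q+q. f (k div q) (k mod q))"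
    by (rule sum.nat_group[symmetric])
  also have "\<dots> = (\<Sum>x<b. \<Sum>y<q. f x y)"
  proof (rule sum.cong[OF refl])
    fix x
    have "(\<Sum>k=x*q..<x*q+q. f (k div q) (k mod q)) = (\<Sum>y=0..<q. f ((x*q+y) div q) ((x*q+y) mod q))"
      using sum.shift_bounds_nat_ivl[of "\<lambda>k. f (k div q) (k mod q)" 0 "x*q" q] by (simp add: add.commute)
    also have "\<dots> = (\<Sum>y=0..<q. f x y)" using False by (intro sum.cong) simp_all
    finally show "(\<Sum>k=x*q..<x*q+q. f (k div q) (k mod q)) = (\<Sum>y<q. f x y)"
      by (simp only: atLeast0LessThan)
  qed
  finally show ?thesis .
qed simp

lemma kronecker_mat_mult:
  fixes A B C D :: "real mat"
  assumes A: "A \<in> carrier_mat a b" and B: "B \<in> carrier_mat p q"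
    and C: "C \<in> carrier_mat b c" and D: "D \<in> carrier_mat q r"
  shows "kronecker_mat A B * kronecker_mat C D = kronecker_mat (A * C) (B * D)"
proof (rule eq_matI)
  have AC: "A * C \<in> carrier_mat a c" and BD: "B * D \<in> carrier_mat p r" using assms by auto
  have AB: "kronecker_mat A B \<in> carrier_mat (a * p) (b * q)"
    and CD: "kronecker_mat C D \<in> carrier_mat (b * q) (c * r)"
    and ACBD: "kronecker_mat (A * C) (B * D) \<in> carrier_mat (a * p) (c * r)"
    using assms AC BD by auto
  then show "dim_row (kronecker_mat A B * kronecker_mat C D) = dim_row (kronecker_mat (A * C) (B * D))"
    "dim_col (kronecker_mat A B * kronecker_mat C D) = dim_col (kronecker_mat (A * C) (B * D))" by auto
  fix i j assume "i < dim_row (kronecker_mat (A * C) (B * D))" "j < dim_col (kronecker_mat (A * C) (B * D))"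
  then have ij: "i < a * p" "j < c * r" using ACBD by auto
  note lt = div_mod_less[OF ij(1)] div_mod_less[OF ij(2)]
  have "(kronecker_mat A B * kronecker_mat C D) $$ (i, j)
      = (\<Sum>k<b * q. kronecker_mat A B $$ (i, k) * kronecker_mat C D $$ (k, j))"
    using AB CD ij by (simp add: scalar_prod_def atLeast0LessThan)
  also have "\<dots> = (\<Sum>k<b * q. (A $$ (i div p, k div q) * C $$ (k div q, j div r)) *
        (B $$ (i mod p, k mod q) * D $$ (k mod q, j mod r)))"
    using ij by (intro sum.cong) (auto simp: index_kronecker_mat[OF A B] index_kronecker_mat[OF C D])
  also have "\<dots> = (\<Sum>x<b. \<Sum>y<q. (A $$ (i div p, x) * C $$ (x, j div r)) * (B $$ (i mod p, y) * D $$ (y, j mod r)))"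
    by (rule sum_div_mod)
  also have "\<dots> = (A * C) $$ (i div p, j div r) * (B * D) $$ (i mod p, j mod r)"
    using lt assms by (simp add: scalar_prod_def atLeast0LessThan sum_product)
  also have "\<dots> = kronecker_mat (A * C) (B * D) $$ (i, j)"
    using index_kronecker_mat[OF AC BD ij] by simp
  finally show "(kronecker_mat A B * kronecker_mat C D) $$ (i, j) = kronecker_mat (A * C) (B * D) $$ (i, j)" .
qed

lemma kronecker_mat_one: "kronecker_mat (1\<^sub>m a) (1\<^sub>m p) = 1\<^sub>m (a * p)"
proof (rule eq_matI)
  fix i j assume "i < dim_row (1\<^sub>m (a * p))" "j < dim_col (1\<^sub>m (a * p))"
  then have ij: "i < a * p" "j < a * p" by auto
  have eq: "i = j \<longleftrightarrow> i div p = j div p \<and> i mod p = j mod p"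
  proof
    assume h: "i div p = j div p \<and> i mod p = j mod p"
    have "i = i mod p + p * (i div p)" by (rule mod_mult_div_eq[symmetric])
    also have "\<dots> = j mod p + p * (j div p)" using h by (simp only:)
    also have "\<dots> = j" by (rule mod_mult_div_eq)
    finally show "i = j" .
  qed simp
  show "kronecker_mat (1\<^sub>m a) (1\<^sub>m p) $$ (i, j) = 1\<^sub>m (a * p) $$ (i, j)"
    using ij div_mod_less[OF ij(1)] div_mod_less[OF ij(2)]
    by (simp add: index_kronecker_mat[OF one_carrier_mat one_carrier_mat ij] eq)
qed (auto simp: kronecker_mat_def)

lemma transpose_kronecker_mat: "(kronecker_mat A B)\<^sup>T = kronecker_mat (A\<^sup>T) (B\<^sup>T)"
proof (rule eq_matI)
  fix i j assume "i < dim_row (kronecker_mat (A\<^sup>T) (B\<^sup>T))" "j < dim_col (kronecker_mat (A\<^sup>T) (B\<^sup>T))"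
  then have ij: "i < dim_col A * dim_col B" "j < dim_row A * dim_row B" by (auto simp: kronecker_mat_def)
  then show "(kronecker_mat A B)\<^sup>T $$ (i, j) = kronecker_mat (A\<^sup>T) (B\<^sup>T) $$ (i, j)"
    using div_mod_less[OF ij(1)] div_mod_less[OF ij(2)] by (simp add: kronecker_mat_def)
qed (auto simp: kronecker_mat_def)

lemma foldl_minus_conj:
  fixes C V :: "real mat"
  assumes "C \<in> carrier_mat n n" "set Ks \<subseteq> carrier_mat n n" "V \<in> carrier_mat n n"
  shows "foldl (-) (V\<^sup>T * C * V) (map (\<lambda>K. V\<^sup>T * K * V) Ks) = V\<^sup>T * foldl (-) C Ks * V"
  using assms
proof (induction Ks arbitrary: C)
  case (Cons K Ks)
  have VT: "V\<^sup>T \<in> carrier_mat n n" and K: "K \<in> carrier_mat n n" using Cons.prems by auto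
  have "V\<^sup>T * C * V - V\<^sup>T * K * V = V\<^sup>T * (C - K) * V"
    unfolding mult_minus_distrib_mat[OF VT Cons.prems(1) K]
    by (rule minus_mult_distrib_mat[OF mult_carrier_mat[OF VT Cons.prems(1)]
          mult_carrier_mat[OF VT K] Cons.prems(3), symmetric])
  moreover have "C - K \<in> carrier_mat n n" using K by (rule minus_carrier_mat)
  ultimately show ?case using Cons.IH[of "C - K"] Cons.prems by simp
qed simp

text \<open>
  The mixed product rule gives \<open>(U\<^sup>T M U) \<otimes> Y = (U \<otimes> I)\<^sup>T (M \<otimes> Y) (U \<otimes> I)\<close>, and \<open>U \<otimes> I\<close> is orthogonal
  because \<open>U\<close> is, so the constant term of the pencil is preserved as well.
\<close>

lemma lin_pencil_conj:
  assumes A: "set A \<subseteq> carrier_mat d d" and X: "set X \<subseteq> carrier_mat n n"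
    and U: "U \<in> carrier_mat d d" "U\<^sup>T * U = 1\<^sub>m d"
  defines "V \<equiv> kronecker_mat U (1\<^sub>m n)"
  shows "lin_pencil d n (map (\<lambda>M. U\<^sup>T * M * U) A) X = V\<^sup>T * lin_pencil d n A X * V"
    and "V \<in> carrier_mat (d * n) (d * n)" and "V\<^sup>T * V = 1\<^sub>m (d * n)" and "V * V\<^sup>T = 1\<^sub>m (d * n)"
proof -
  have VT: "V\<^sup>T = kronecker_mat (U\<^sup>T) (1\<^sub>m n)" by (simp add: V_def transpose_kronecker_mat)
  show V: "V \<in> carrier_mat (d * n) (d * n)" using U by (simp add: V_def)
  show VV: "V\<^sup>T * V = 1\<^sub>m (d * n)"
    unfolding VT unfolding V_def using U
    by (subst kronecker_mat_mult[of _ d d _ n n _ d _ n]) (auto simp: kronecker_mat_one)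
  show "V * V\<^sup>T = 1\<^sub>m (d * n)" using mat_mult_left_right_inverse[OF _ V VV] V by simp
  have kr: "kronecker_mat (U\<^sup>T * M * U) Y = V\<^sup>T * kronecker_mat M Y * V"
    if M: "M \<in> carrier_mat d d" and Y: "Y \<in> carrier_mat n n" for M Y
  proof -
    have UT: "U\<^sup>T \<in> carrier_mat d d" and UTM: "U\<^sup>T * M \<in> carrier_mat d d" using U M by auto
    have "V\<^sup>T * kronecker_mat M Y = kronecker_mat (U\<^sup>T * M) (1\<^sub>m n * Y)"
      unfolding VT by (rule kronecker_mat_mult[OF UT one_carrier_mat M Y])
    then have "V\<^sup>T * kronecker_mat M Y * V = kronecker_mat (U\<^sup>T * M) Y * kronecker_mat U (1\<^sub>m n)"
      using Y by (simp add: V_def)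
    also have "\<dots> = kronecker_mat (U\<^sup>T * M * U) (Y * 1\<^sub>m n)"
      by (rule kronecker_mat_mult[OF UTM Y U(1) one_carrier_mat])
    finally show ?thesis using Y by simp
  qed
  have "map2 kronecker_mat (map (\<lambda>M. U\<^sup>T * M * U) A) X =
      map (\<lambda>K. V\<^sup>T * K * V) (map2 kronecker_mat A X)"
  proof -
    have "kronecker_mat (U\<^sup>T * M * U) Y = V\<^sup>T * kronecker_mat M Y * V" if "(M, Y) \<in> set (zip A X)" for M Y
      using kr[of M Y] A X set_zip_leftD[OF that] set_zip_rightD[OF that] by blast
    then show ?thesis by (auto simp: zip_map1)
  qed
  moreover have "V\<^sup>T * 1\<^sub>m (d * n) * V = 1\<^sub>m (d * n)" using V VV by simp
  ultimately show "lin_pencil d n (map (\<lambda>M. U\<^sup>T * M * U) A) X = V\<^sup>T * lin_pencil d n A X * V"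
    unfolding lin_pencil_def using foldl_minus_conj[OF _ map2_kronecker_subset[OF A X] V, of "1\<^sub>m (d * n)"]
    by simp
qed

lemma psd_mat_conj:
  assumes psd: "psd_mat M" and M: "M \<in> carrier_mat n n" and V: "V \<in> carrier_mat n m"
  shows "psd_mat (V\<^sup>T * M * V)"
proof -
  have sym: "M\<^sup>T = M" using psd by (simp add: psd_mat_def)
  have VT: "V\<^sup>T \<in> carrier_mat m n" using V by simp
  have car: "V\<^sup>T * M * V \<in> carrier_mat m m" using V M by simp
  have MV: "M * V \<in> carrier_mat n m" using M V by simp
  have "(V\<^sup>T * M * V)\<^sup>T = (V\<^sup>T * (M * V))\<^sup>T" using assoc_mult_mat[OF VT M V] by simp
  also have "\<dots> = (M * V)\<^sup>T * V" using transpose_mult[OF VT MV] by simp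
  also have "(M * V)\<^sup>T = V\<^sup>T * M" using transpose_mult[OF M V] sym by simp
  finally have "(V\<^sup>T * M * V)\<^sup>T = V\<^sup>T * M * V" .
  moreover have "v \<bullet> ((V\<^sup>T * M * V) *\<^sub>v v) \<ge> 0" if v: "v \<in> carrier_vec m" for v
  proof -
    have Vv: "V *\<^sub>v v \<in> carrier_vec n" using V v by simp
    have e: "(V\<^sup>T * M * V) *\<^sub>v v = V\<^sup>T *\<^sub>v (M *\<^sub>v (V *\<^sub>v v))"
      using V VT M v Vv by (simp add: assoc_mult_mat_vec[of _ m n _ m] assoc_mult_mat_vec[of _ m n _ n])
    have "v \<bullet> (V\<^sup>T *\<^sub>v (M *\<^sub>v (V *\<^sub>v v))) = (V *\<^sub>v v) \<bullet> (M *\<^sub>v (V *\<^sub>v v))"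
      using transpose_vec_mult_scalar[OF VT, of "M *\<^sub>v (V *\<^sub>v v)" v] M Vv v by simp
    then show ?thesis using psd M Vv e by (simp add: psd_mat_def)
  qed
  ultimately show ?thesis using car by (auto simp: psd_mat_def)
qed

text \<open>
  Conjugating \<open>A\<close> by \<open>U\<close> conjugates the pencil by the orthogonal matrix \<open>U \<otimes> I\<close>.
\<close>

lemma unitarily_equivalent_lin_pencil:
  assumes "unitarily_equivalent d A B" and A: "A \<in> sym_tuples g d" and X: "X \<in> sym_tuples g n"
  shows "psd_mat (lin_pencil d n B X) \<longleftrightarrow> psd_mat (lin_pencil d n A X)"
    and "kernel_dim (lin_pencil d n B X) = kernel_dim (lin_pencil d n A X)"
proof -
  obtain U where U: "U \<in> carrier_mat d d" "U\<^sup>T * U = 1\<^sub>m d" and B: "map (\<lambda>M. U\<^sup>T * M * U) A = B"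
    using assms(1) by (auto simp: unitarily_equivalent_def)
  define V where "V = kronecker_mat U (1\<^sub>m n)"
  note V = lin_pencil_conj[OF sym_tuplesD(4)[OF A] sym_tuplesD(4)[OF X] U, unfolded B, folded V_def]
  define L where "L = lin_pencil d n A X"
  have L: "L \<in> carrier_mat (d * n) (d * n)"
    unfolding L_def by (rule lin_pencil_sym_carrier[OF A X])
  have VT: "V\<^sup>T \<in> carrier_mat (d * n) (d * n)" using V by simp
  have M: "V\<^sup>T * L * V \<in> carrier_mat (d * n) (d * n)" using V VT L by simp
  have undo: "(V\<^sup>T)\<^sup>T * (V\<^sup>T * L * V) * V\<^sup>T = L"
  proof -
    have LV: "L * V \<in> carrier_mat (d * n) (d * n)" using L V(2) by simp
    have "V * (V\<^sup>T * L * V) = (V * V\<^sup>T) * (L * V)"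
      unfolding assoc_mult_mat[OF VT L V(2)] by (rule assoc_mult_mat[OF V(2) VT LV, symmetric])
    then have "V * (V\<^sup>T * L * V) * V\<^sup>T = (L * V) * V\<^sup>T"
      unfolding V(4) left_mult_one_mat[OF LV] by (rule arg_cong)
    also have "\<dots> = L" unfolding assoc_mult_mat[OF L V(2) VT] V(4) using L by simp
    finally show ?thesis by simp
  qed
  show "psd_mat (lin_pencil d n B X) \<longleftrightarrow> psd_mat (lin_pencil d n A X)"
    unfolding V(1) L_def[symmetric]
    using psd_mat_conj[OF _ L V(2)] psd_mat_conj[OF _ M VT] unfolding undo by blast
  have "similar_mat_wit (V\<^sup>T * L * V) L (V\<^sup>T) V"
    using V VT L M by (auto simp: similar_mat_wit_def Let_def)
  from similar_mat_wit_kernel_dim[OF M this]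
  show "kernel_dim (lin_pencil d n B X) = kernel_dim (lin_pencil d n A X)"
    unfolding V(1) L_def[symmetric] kernel_dim_def carrier_matD(2)[OF M] carrier_matD(2)[OF L] .
qed

section \<open>Dilations by one row and column\<close>

text \<open>
  The matrix \<open>\<Sum>\<^sub>k A\<^sub>k \<otimes> b\<^sub>k\<^sup>T\<close>, where \<open>b\<^sub>k\<close> is the column with entries \<open>b k r\<close>, \<open>r < n\<close>.
\<close>

definition pencil_border :: "nat \<Rightarrow> nat \<Rightarrow> nat \<Rightarrow> real mat list \<Rightarrow> (nat \<Rightarrow> nat \<Rightarrow> real) \<Rightarrow> real mat" where
  "pencil_border g d n A b = mat d (d * n) (\<lambda>(q, j). \<Sum>k<g. A ! k $$ (q, j div n) * b k (j mod n))"

text \<open>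
  Dilations by one row and column with zero corner suffice; the entries of the new columns are kept
  as a function so that they can be scaled and solved for.
\<close>

definition column_dilation :: "nat \<Rightarrow> nat \<Rightarrow> real mat list \<Rightarrow> (nat \<Rightarrow> nat \<Rightarrow> real) \<Rightarrow> real mat list" where
  "column_dilation g n X b =
     block_tuple g X (map (\<lambda>k. mat n 1 (\<lambda>(r, _). b k r)) [0..<g]) (replicate g (0\<^sub>m 1 1))"

text \<open>
  In a vector indexed by pairs \<open>(p, r)\<close> with \<open>r < n + 1\<close>, the entries with \<open>r = n\<close> meet the new row and
  column of a dilated tuple. Extracting the other entries and these replaces the permutation
  of coordinates that would bring the pencil of the dilation into block form.
\<close>

definition inner_part :: "nat \<Rightarrow> nat \<Rightarrow> real vec \<Rightarrow> real vec" where
  "inner_part d n v = vec (d * n) (\<lambda>i. v $ (i div n * (n + 1) + i mod n))"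

definition border_part :: "nat \<Rightarrow> nat \<Rightarrow> real vec \<Rightarrow> real vec" where
  "border_part d n v = vec d (\<lambda>p. v $ (p * (n + 1) + n))"

lemma pencil_border_carrier: "pencil_border g d n A b \<in> carrier_mat d (d * n)"
  by (simp add: pencil_border_def)

lemma column_dilation_sym:
  assumes X: "X \<in> sym_tuples g n"
  shows "column_dilation g n X b \<in> sym_tuples g (n + 1)"
proof -
  have "(0\<^sub>m 1 1)\<^sup>T = (0\<^sub>m 1 1 :: real mat)" by (intro eq_matI) auto
  then show ?thesis
    unfolding column_dilation_def block_tuple_def using sym_tuplesD(2,3)[OF X]
    by (intro sym_tuples_mapI four_block_carrier_mat)
      (auto simp: transpose_four_block_mat[of _ n n _ 1 _ 1])
qed

lemma index_column_dilation:
  assumes X: "X \<in> sym_tuples g n" and k: "k < g"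
  shows "r < n \<Longrightarrow> s < n \<Longrightarrow> column_dilation g n X b ! k $$ (r, s) = X ! k $$ (r, s)"
    and "r < n \<Longrightarrow> column_dilation g n X b ! k $$ (r, n) = b k r"
    and "s < n \<Longrightarrow> column_dilation g n X b ! k $$ (n, s) = b k s"
    and "column_dilation g n X b ! k $$ (n, n) = 0"
  using sym_tuplesD(2)[OF X k] k by (auto simp: column_dilation_def block_tuple_def)

lemma pair_index_less:
  fixes p r d n :: nat
  assumes "p < d" "r < n"
  shows "p * n + r < d * n" "(p * n + r) div n = p" "(p * n + r) mod n = r"
proof -
  have "p * n + r < (p + 1) * n" using assms by simp
  also have "\<dots> \<le> d * n" using assms by (intro mult_le_mono1) simp
  finally show "p * n + r < d * n" .
qed (use assms in auto)

lemma sum_pairs: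
  fixes f :: "nat \<Rightarrow> real"
  shows "(\<Sum>i<d * n. f i) = (\<Sum>p<d. \<Sum>r<n. f (p * n + r))"
  using sum_div_mod[of "\<lambda>p r. f (p * n + r)" n d] by simp

lemma vec_eq_pairsI:
  assumes "v \<in> carrier_vec (d * n)" "w \<in> carrier_vec (d * n)"
    and "\<And>p r. p < d \<Longrightarrow> r < n \<Longrightarrow> v $ (p * n + r) = w $ (p * n + r)"
  shows "v = w"
proof (rule eq_vecI)
  fix i assume "i < dim_vec w"
  then have "i < d * n" using assms by simp
  from assms(3)[OF div_mod_less[OF this]] show "v $ i = w $ i" by simp
qed (use assms in simp)

lemma index_lin_pencil_mult_vec:
  assumes A: "A \<in> sym_tuples g d" and X: "X \<in> sym_tuples g n"
    and v: "v \<in> carrier_vec (d * n)" and p: "p < d" and r: "r < n"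
  shows "(lin_pencil d n A X *\<^sub>v v) $ (p * n + r) = v $ (p * n + r) -
    (\<Sum>k<g. \<Sum>q<d. \<Sum>s<n. A ! k $$ (p, q) * X ! k $$ (r, s) * v $ (q * n + s))"
proof -
  define i where "i = p * n + r"
  have i: "i < d * n" and pr: "i div n = p" "i mod n = r" using pair_index_less[OF p r] by (auto simp: i_def)
  define S where "S j = (\<Sum>k<g. A ! k $$ (p, j div n) * X ! k $$ (r, j mod n))" for j
  have "(lin_pencil d n A X *\<^sub>v v) $ i = (\<Sum>j<d * n. lin_pencil d n A X $$ (i, j) * v $ j)"
    using lin_pencil_sym_carrier[OF A X] v i by (simp add: scalar_prod_def atLeast0LessThan)
  also have "\<dots> = (\<Sum>j<d * n. (if i = j then v $ j else 0) - S j * v $ j)"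
    using i by (intro sum.cong) (auto simp: index_lin_pencil[OF A X] pr S_def left_diff_distrib)
  also have "\<dots> = v $ i - (\<Sum>j<d * n. S j * v $ j)"
    using i by (simp add: sum_subtractf)
  also have "(\<Sum>j<d * n. S j * v $ j) = (\<Sum>q<d. \<Sum>s<n. S (q * n + s) * v $ (q * n + s))"
    by (rule sum_pairs)
  also have "\<dots> = (\<Sum>q<d. \<Sum>s<n. \<Sum>k<g. A ! k $$ (p, q) * X ! k $$ (r, s) * v $ (q * n + s))"
    by (intro sum.cong refl) (simp add: S_def pair_index_less sum_distrib_right)
  also have "\<dots> = (\<Sum>q<d. \<Sum>k<g. \<Sum>s<n. A ! k $$ (p, q) * X ! k $$ (r, s) * v $ (q * n + s))"
    by (intro sum.cong refl sum.swap)
  also have "\<dots> = (\<Sum>k<g. \<Sum>q<d. \<Sum>s<n. A ! k $$ (p, q) * X ! k $$ (r, s) * v $ (q * n + s))"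
    by (rule sum.swap)
  finally show ?thesis by (simp only: i_def)
qed

lemma index_pencil_border_mult_vec:
  assumes u: "u \<in> carrier_vec (d * n)" and q: "q < d"
  shows "(pencil_border g d n A b *\<^sub>v u) $ q =
    (\<Sum>k<g. \<Sum>p<d. \<Sum>r<n. A ! k $$ (q, p) * b k r * u $ (p * n + r))"
proof -
  have "(pencil_border g d n A b *\<^sub>v u) $ q =
      (\<Sum>j<d * n. (\<Sum>k<g. A ! k $$ (q, j div n) * b k (j mod n)) * u $ j)"
    using u q by (simp add: pencil_border_def scalar_prod_def atLeast0LessThan)
  also have "\<dots> = (\<Sum>p<d. \<Sum>r<n. (\<Sum>k<g. A ! k $$ (q, p) * b k r) * u $ (p * n + r))"
    unfolding sum_pairs by (intro sum.cong refl) (simp add: pair_index_less)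
  also have "\<dots> = (\<Sum>p<d. \<Sum>r<n. \<Sum>k<g. A ! k $$ (q, p) * b k r * u $ (p * n + r))"
    by (simp only: sum_distrib_right)
  also have "\<dots> = (\<Sum>p<d. \<Sum>k<g. \<Sum>r<n. A ! k $$ (q, p) * b k r * u $ (p * n + r))"
    by (intro sum.cong refl sum.swap)
  also have "\<dots> = (\<Sum>k<g. \<Sum>p<d. \<Sum>r<n. A ! k $$ (q, p) * b k r * u $ (p * n + r))"
    by (rule sum.swap)
  finally show ?thesis .
qed

lemma inner_part_carrier: "inner_part d n v \<in> carrier_vec (d * n)"
  by (simp add: inner_part_def)

lemma inner_part_index:
  assumes "p < d" "r < n"
  shows "inner_part d n v $ (p * n + r) = v $ (p * (n + 1) + r)"
  unfolding inner_part_def index_vec[OF pair_index_less(1)[OF assms]] pair_index_less(2,3)[OF assms] ..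

text \<open>
  Splitting off the border is an isometry of \<open>\<real>\<^bsup>d(n+1)\<^esup>\<close> with \<open>\<real>\<^bsup>dn\<^esup> \<times> \<real>\<^bsup>d\<^esup>\<close>.
\<close>

lemma scalar_prod_parts:
  assumes "v \<in> carrier_vec (d * (n + 1))" "w \<in> carrier_vec (d * (n + 1))"
  shows "v \<bullet> w = inner_part d n v \<bullet> inner_part d n w + border_part d n v \<bullet> border_part d n w"
proof -
  have "v \<bullet> w = (\<Sum>p<d. \<Sum>r<n + 1. v $ (p * (n + 1) + r) * w $ (p * (n + 1) + r))"
    using assms sum_pairs[of "\<lambda>i. v $ i * w $ i" d "n + 1"] by (simp add: scalar_prod_def atLeast0LessThan)
  also have "\<dots> = (\<Sum>p<d. \<Sum>r<n. v $ (p * (n + 1) + r) * w $ (p * (n + 1) + r))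
      + (\<Sum>p<d. v $ (p * (n + 1) + n) * w $ (p * (n + 1) + n))"
    by (simp add: sum.distrib)
  also have "(\<Sum>p<d. \<Sum>r<n. v $ (p * (n + 1) + r) * w $ (p * (n + 1) + r))
      = (\<Sum>p<d. \<Sum>r<n. inner_part d n v $ (p * n + r) * inner_part d n w $ (p * n + r))"
    by (intro sum.cong refl) (simp add: inner_part_index)
  also have "\<dots> = inner_part d n v \<bullet> inner_part d n w"
    unfolding scalar_prod_def carrier_vecD[OF inner_part_carrier] atLeast0LessThan
    by (rule sum_pairs[symmetric])
  also have "(\<Sum>p<d. v $ (p * (n + 1) + n) * w $ (p * (n + 1) + n)) = border_part d n v \<bullet> border_part d n w"
    by (simp add: scalar_prod_def atLeast0LessThan border_part_def)
  finally show ?thesis .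
qed

text \<open>
  In the coordinates given by the two parts, the pencil of the dilated tuple is the block matrix
  \<open>[[L, -N\<^sup>T], [-N, I]]\<close>; the lower right block is the identity because the new corner is zero.
\<close>

lemma parts_lin_pencil_column_dilation:
  fixes b :: "nat \<Rightarrow> nat \<Rightarrow> real"
  assumes A: "A \<in> sym_tuples g d" and X: "X \<in> sym_tuples g n" and v: "v \<in> carrier_vec (d * (n + 1))"
  defines "w \<equiv> lin_pencil d (n + 1) A (column_dilation g n X b) *\<^sub>v v"
  shows "inner_part d n w = lin_pencil d n A X *\<^sub>v inner_part d n v
           - (pencil_border g d n A b)\<^sup>T *\<^sub>v border_part d n v"
    and "border_part d n w = border_part d n v - pencil_border g d n A b *\<^sub>v inner_part d n v"
proof -
  define u t where "u = inner_part d n v" and "t = border_part d n v"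
  define Z where "Z = column_dilation g n X b"
  have u: "u \<in> carrier_vec (d * n)" and t: "t \<in> carrier_vec d" by (auto simp: u_def t_def inner_part_def border_part_def)
  have Z: "Z \<in> sym_tuples g (n + 1)" unfolding Z_def by (rule column_dilation_sym[OF X])
  have N: "pencil_border g d n A b \<in> carrier_mat d (d * n)" by (rule pencil_border_carrier)
  have L: "lin_pencil d n A X \<in> carrier_mat (d * n) (d * n)" by (rule lin_pencil_sym_carrier[OF A X])
  note act = index_lin_pencil_mult_vec[OF A Z v, folded w_def[folded Z_def]]
  have entry: "w $ (p * (n + 1) + r) = v $ (p * (n + 1) + r) -
      ((\<Sum>k<g. \<Sum>q<d. \<Sum>s<n. A ! k $$ (p, q) * Z ! k $$ (r, s) * u $ (q * n + s))
       + (\<Sum>k<g. \<Sum>q<d. A ! k $$ (p, q) * Z ! k $$ (r, n) * t $ q))" if "p < d" "r < n + 1" for p r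
  proof -
    have "(\<Sum>s<n + 1. A ! k $$ (p, q) * Z ! k $$ (r, s) * v $ (q * (n + 1) + s))
        = (\<Sum>s<n. A ! k $$ (p, q) * Z ! k $$ (r, s) * u $ (q * n + s)) + A ! k $$ (p, q) * Z ! k $$ (r, n) * t $ q"
      if "q < d" for k q
      using that by (simp add: u_def t_def inner_part_index border_part_def)
    then show ?thesis unfolding act[OF that] sum.distrib[symmetric]
      by (intro arg_cong2[of _ _ _ _ minus] refl sum.cong) simp_all
  qed
  show "border_part d n w = border_part d n v - pencil_border g d n A b *\<^sub>v inner_part d n v"
    unfolding u_def[symmetric] t_def[symmetric]
  proof (rule eq_vecI)
    fix p assume "p < dim_vec (t - pencil_border g d n A b *\<^sub>v u)"
    then have p: "p < d" using N by simp
    have "border_part d n w $ p = w $ (p * (n + 1) + n)" using p by (simp add: border_part_def)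
    also have "\<dots> = t $ p - (\<Sum>k<g. \<Sum>q<d. \<Sum>s<n. A ! k $$ (p, q) * b k s * u $ (q * n + s))"
      using p unfolding entry[OF p less_add_one]
      by (simp add: index_column_dilation[OF X] Z_def t_def border_part_def)
    also have "\<dots> = (t - pencil_border g d n A b *\<^sub>v u) $ p"
      using p N t by (simp add: index_pencil_border_mult_vec[OF u p] del: index_mult_mat_vec)
    finally show "border_part d n w $ p = (t - pencil_border g d n A b *\<^sub>v u) $ p" .
  qed (use N t in \<open>simp add: border_part_def\<close>)
  show "inner_part d n w = lin_pencil d n A X *\<^sub>v inner_part d n v
      - (pencil_border g d n A b)\<^sup>T *\<^sub>v border_part d n v"
    unfolding u_def[symmetric] t_def[symmetric]
  proof (rule vec_eq_pairsI)
    show "inner_part d n w \<in> carrier_vec (d * n)" by (simp add: inner_part_def)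
    show "lin_pencil d n A X *\<^sub>v u - (pencil_border g d n A b)\<^sup>T *\<^sub>v t \<in> carrier_vec (d * n)"
      using L N by (intro carrier_vecI) simp
    fix p r assume p: "p < d" and r: "r < n"
    have tr: "((pencil_border g d n A b)\<^sup>T *\<^sub>v t) $ (p * n + r) =
        (\<Sum>k<g. \<Sum>q<d. A ! k $$ (p, q) * b k r * t $ q)"
    proof -
      have "((pencil_border g d n A b)\<^sup>T *\<^sub>v t) $ (p * n + r) =
          (\<Sum>q<d. (\<Sum>k<g. A ! k $$ (q, p) * b k r) * t $ q)"
        using pair_index_less[OF p r] t by (simp add: pencil_border_def scalar_prod_def atLeast0LessThan)
      also have "\<dots> = (\<Sum>q<d. \<Sum>k<g. A ! k $$ (p, q) * b k r * t $ q)"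
        unfolding sum_distrib_right using p by (intro sum.cong refl) (simp add: sym_tuples_index_commute[OF A])
      also have "\<dots> = (\<Sum>k<g. \<Sum>q<d. A ! k $$ (p, q) * b k r * t $ q)" by (rule sum.swap)
      finally show ?thesis .
    qed
    have r': "r < n + 1" using r by simp
    have "inner_part d n w $ (p * n + r) = w $ (p * (n + 1) + r)" by (rule inner_part_index[OF p r])
    also have "\<dots> = u $ (p * n + r) -
        ((\<Sum>k<g. \<Sum>q<d. \<Sum>s<n. A ! k $$ (p, q) * X ! k $$ (r, s) * u $ (q * n + s))
         + (\<Sum>k<g. \<Sum>q<d. A ! k $$ (p, q) * b k r * t $ q))"
      unfolding entry[OF p r'] using r by (simp add: index_column_dilation[OF X] Z_def u_def inner_part_index[OF p r])
    also have "\<dots> = (lin_pencil d n A X *\<^sub>v u) $ (p * n + r) - ((pencil_border g d n A b)\<^sup>T *\<^sub>v t) $ (p * n + r)"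
      unfolding index_lin_pencil_mult_vec[OF A X u p r] tr by (simp only: diff_diff_eq)
    also have "\<dots> = (lin_pencil d n A X *\<^sub>v u - (pencil_border g d n A b)\<^sup>T *\<^sub>v t) $ (p * n + r)"
      using pair_index_less(1)[OF p r] N by simp
    finally show "inner_part d n w $ (p * n + r) =
      (lin_pencil d n A X *\<^sub>v u - (pencil_border g d n A b)\<^sup>T *\<^sub>v t) $ (p * n + r)" .
  qed
qed

text \<open>
  One half of the Schur complement criterion: for a vector with parts \<open>u\<close> and \<open>t\<close> the form is
  \<open>u \<bullet> L u - 2 t \<bullet> N u + t \<bullet> t\<close>, which the hypothesis bounds below by the squared length of
  \<open>t - N u\<close>.
\<close>

lemma psd_lin_pencil_column_dilation:
  assumes A: "A \<in> sym_tuples g d" and X: "X \<in> sym_tuples g n"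
    and dom: "\<And>u. u \<in> carrier_vec (d * n) \<Longrightarrow>
      (pencil_border g d n A b *\<^sub>v u) \<bullet> (pencil_border g d n A b *\<^sub>v u) \<le> u \<bullet> (lin_pencil d n A X *\<^sub>v u)"
  shows "psd_mat (lin_pencil d (n + 1) A (column_dilation g n X b))"
proof -
  define Z L N where "Z = column_dilation g n X b" and "L = lin_pencil d n A X" and "N = pencil_border g d n A b"
  have Z: "Z \<in> sym_tuples g (n + 1)" unfolding Z_def by (rule column_dilation_sym[OF X])
  have LZ: "lin_pencil d (n + 1) A Z \<in> carrier_mat (d * (n + 1)) (d * (n + 1))"
    by (rule lin_pencil_sym_carrier[OF A Z])
  have L: "L \<in> carrier_mat (d * n) (d * n)" unfolding L_def by (rule lin_pencil_sym_carrier[OF A X])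
  have N: "N \<in> carrier_mat d (d * n)" unfolding N_def by (rule pencil_border_carrier)
  have "v \<bullet> (lin_pencil d (n + 1) A Z *\<^sub>v v) \<ge> 0" if v: "v \<in> carrier_vec (d * (n + 1))" for v
  proof -
    define u t where "u = inner_part d n v" and "t = border_part d n v"
    have u: "u \<in> carrier_vec (d * n)" and t: "t \<in> carrier_vec d" by (auto simp: u_def t_def inner_part_def border_part_def)
    have Lu: "L *\<^sub>v u \<in> carrier_vec (d * n)" and Nu: "N *\<^sub>v u \<in> carrier_vec d"
      and Nt: "N\<^sup>T *\<^sub>v t \<in> carrier_vec (d * n)" using L N u t by auto
    have LZv: "lin_pencil d (n + 1) A Z *\<^sub>v v \<in> carrier_vec (d * (n + 1))" using LZ v by simp
    have utN: "u \<bullet> (N\<^sup>T *\<^sub>v t) = t \<bullet> (N *\<^sub>v u)"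
      using transpose_vec_mult_scalar[OF N u t] comm_scalar_prod[OF Nt u] by simp
    have "v \<bullet> (lin_pencil d (n + 1) A Z *\<^sub>v v) = u \<bullet> (L *\<^sub>v u - N\<^sup>T *\<^sub>v t) + t \<bullet> (t - N *\<^sub>v u)"
      unfolding scalar_prod_parts[OF v LZv] unfolding Z_def
      by (simp only: parts_lin_pencil_column_dilation[OF A X v] u_def t_def L_def N_def)
    also have "\<dots> = u \<bullet> (L *\<^sub>v u) - 2 * (t \<bullet> (N *\<^sub>v u)) + t \<bullet> t"
      unfolding scalar_prod_minus_distrib[OF u Lu Nt] scalar_prod_minus_distrib[OF t t Nu] utN by simp
    also have "\<dots> \<ge> (N *\<^sub>v u) \<bullet> (N *\<^sub>v u) - 2 * (t \<bullet> (N *\<^sub>v u)) + t \<bullet> t"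
      using dom[OF u] unfolding N_def L_def by simp
    moreover have "(N *\<^sub>v u) \<bullet> (N *\<^sub>v u) - 2 * (t \<bullet> (N *\<^sub>v u)) + t \<bullet> t = (t - N *\<^sub>v u) \<bullet> (t - N *\<^sub>v u)"
    proof -
      have "t - N *\<^sub>v u \<in> carrier_vec d" using t Nu by simp
      then show ?thesis using comm_scalar_prod[OF Nu t]
        by (simp add: minus_scalar_prod_distrib[OF t Nu] scalar_prod_minus_distrib[OF t t Nu]
            scalar_prod_minus_distrib[OF Nu t Nu])
    qed
    ultimately show ?thesis using scalar_prod_self_nonneg[of "t - N *\<^sub>v u"] by linarith
  qed
  then show ?thesis using LZ transpose_lin_pencil[OF A Z] by (auto simp: psd_mat_def Z_def)
qed

section \<open>Counting equations for dilations\<close>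

lemma pencil_border_scale: "pencil_border g d n A (\<lambda>k r. c * b k r) = c \<cdot>\<^sub>m pencil_border g d n A b"
  by (intro eq_matI) (auto simp: pencil_border_def sum_distrib_left algebra_simps)

lemma pencil_border_mult_zero_on_span:
  assumes Z: "Z \<in> carrier_mat (d * n) m"
    and gen: "\<And>s. s < m \<Longrightarrow> pencil_border g d n A b *\<^sub>v col Z s = 0\<^sub>v d"
    and c: "c \<in> carrier_vec m"
  shows "pencil_border g d n A b *\<^sub>v (Z *\<^sub>v c) = 0\<^sub>v d"
proof -
  have N: "pencil_border g d n A b \<in> carrier_mat d (d * n)" by (rule pencil_border_carrier)
  have "pencil_border g d n A b * Z = 0\<^sub>m d m"
  proof (rule eq_matI)
    fix i j assume "i < dim_row (0\<^sub>m d m :: real mat)" "j < dim_col (0\<^sub>m d m :: real mat)"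
    then have ij: "i < d" "j < m" by auto
    then have "(pencil_border g d n A b * Z) $$ (i, j) = (pencil_border g d n A b *\<^sub>v col Z j) $ i"
      using N Z by simp
    then show "(pencil_border g d n A b * Z) $$ (i, j) = 0\<^sub>m d m $$ (i, j)" using gen[OF ij(2)] ij by simp
  qed (use N Z in auto)
  then have "pencil_border g d n A b *\<^sub>v (Z *\<^sub>v c) = 0\<^sub>m d m *\<^sub>v c"
    using assoc_mult_mat_vec[OF N Z c] by simp
  also have "\<dots> = 0\<^sub>v d" using c by (intro eq_vecI) auto
  finally show ?thesis .
qed

text \<open>
  For a fixed vector \<open>w\<close>, the condition that the border annihilates \<open>w\<close> amounts to \<open>d\<close> linear
  equations in the \<open>g n\<close> entries of the border, which are listed in the vector \<open>x\<close>.
\<close>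

lemma pencil_border_eq_zero_linear:
  fixes g d n :: nat and A :: "real mat list" and w :: "real vec"
  assumes w: "w \<in> carrier_vec (d * n)"
  defines "R \<equiv> \<lambda>q. vec (g * n) (\<lambda>i. \<Sum>p<d. A ! (i div n) $$ (q, p) * w $ (p * n + i mod n))"
  assumes x: "x \<in> carrier_vec (g * n)" and zero: "\<And>q. q < d \<Longrightarrow> R q \<bullet> x = 0"
  shows "pencil_border g d n A (\<lambda>k r. x $ (k * n + r)) *\<^sub>v w = 0\<^sub>v d"
proof (rule eq_vecI)
  fix q assume "q < dim_vec (0\<^sub>v d :: real vec)"
  then have q: "q < d" by simp
  have "R q \<bullet> x = (\<Sum>k<g. \<Sum>r<n. (\<Sum>p<d. A ! k $$ (q, p) * w $ (p * n + r)) * x $ (k * n + r))"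
    using x by (simp add: R_def scalar_prod_def atLeast0LessThan sum_pairs pair_index_less)
  also have "\<dots> = (\<Sum>k<g. \<Sum>r<n. \<Sum>p<d. A ! k $$ (q, p) * x $ (k * n + r) * w $ (p * n + r))"
    unfolding sum_distrib_right by (intro sum.cong refl) simp
  also have "\<dots> = (\<Sum>k<g. \<Sum>p<d. \<Sum>r<n. A ! k $$ (q, p) * x $ (k * n + r) * w $ (p * n + r))"
    by (intro sum.cong refl sum.swap)
  also have "\<dots> = (pencil_border g d n A (\<lambda>k r. x $ (k * n + r)) *\<^sub>v w) $ q"
    by (rule index_pencil_border_mult_vec[OF w q, symmetric])
  finally show "(pencil_border g d n A (\<lambda>k r. x $ (k * n + r)) *\<^sub>v w) $ q = 0\<^sub>v d $ q"
    using zero[OF q] q by (simp del: index_mult_mat_vec)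
qed (simp add: pencil_border_def)

text \<open>
  Each summand contributes its size times the dimension of its kernel many equations. If there are
  fewer equations than unknowns, some nonzero border solves them all.
\<close>

lemma dilation_direction_exists:
  assumes A: "\<And>j. j \<in> set js \<Longrightarrow> Aj j \<in> sym_tuples g (dj j)" and X: "X \<in> sym_tuples g n"
    and less: "(\<Sum>j\<leftarrow>js. dj j * kernel_dim (lin_pencil (dj j) n (Aj j) X)) < g * n"
  obtains k r and b :: "nat \<Rightarrow> nat \<Rightarrow> real" where "k < g" "r < n" "b k r \<noteq> 0"
    and "\<And>j v. j \<in> set js \<Longrightarrow> v \<in> carrier_vec (dj j * n) \<Longrightarrow>
      lin_pencil (dj j) n (Aj j) X *\<^sub>v v = 0\<^sub>v (dj j * n) \<Longrightarrow> pencil_border g (dj j) n (Aj j) b *\<^sub>v v = 0\<^sub>v (dj j)"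
proof -
  define L where "L j = lin_pencil (dj j) n (Aj j) X" for j
  define kj where "kj j = kernel_dim (L j)" for j
  have "\<exists>Z. Z \<in> carrier_mat (dj j * n) (kj j) \<and>
      (\<forall>v \<in> carrier_vec (dj j * n). L j *\<^sub>v v = 0\<^sub>v (dj j * n) \<longrightarrow> (\<exists>c\<in>carrier_vec (kj j). v = Z *\<^sub>v c))"
    if "j \<in> set js" for j
  proof -
    have Lc: "L j \<in> carrier_mat (dj j * n) (dj j * n)"
      unfolding L_def by (rule lin_pencil_sym_carrier[OF A[OF that] X])
    show ?thesis unfolding kj_def by (rule kernel_basis_matrix[OF Lc]) blast
  qed
  then obtain Z where Zc: "\<And>j. j \<in> set js \<Longrightarrow> Z j \<in> carrier_mat (dj j * n) (kj j)"
    and gen: "\<And>j v. j \<in> set js \<Longrightarrow> v \<in> carrier_vec (dj j * n) \<Longrightarrow> L j *\<^sub>v v = 0\<^sub>v (dj j * n) \<Longrightarrow>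
      \<exists>c\<in>carrier_vec (kj j). v = Z j *\<^sub>v c" by metis
  \<comment> \<open>The coefficients of the equation that makes entry \<open>q\<close> of the border applied to column \<open>s\<close> vanish.\<close>
  define R where "R j s q = vec (g * n)
    (\<lambda>i. \<Sum>p<dj j. Aj j ! (i div n) $$ (q, p) * col (Z j) s $ (p * n + i mod n))" for j s q
  define rs where "rs = concat (map (\<lambda>j. map (\<lambda>(s, q). R j s q) (List.product [0..<kj j] [0..<dj j])) js)"
  have "length rs = (\<Sum>j\<leftarrow>js. dj j * kj j)"
    by (simp add: rs_def length_concat comp_def mult.commute)
  then have "length rs < g * n" using less by (simp add: kj_def L_def)
  moreover have "set rs \<subseteq> carrier_vec (g * n)" by (auto simp: rs_def R_def)
  ultimately obtain x where x: "x \<in> carrier_vec (g * n)" "x \<noteq> 0\<^sub>v (g * n)" "\<And>r. r \<in> set rs \<Longrightarrow> r \<bullet> x = 0"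
    using homogeneous_system_nontrivial_solution by metis
  define b where "b k r = x $ (k * n + r)" for k r
  obtain i where i: "i < g * n" "x $ i \<noteq> 0" using x(1,2) by (metis carrier_vecD eq_vecI index_zero_vec)
  show thesis
  proof (rule that[of "i div n" "i mod n" b])
    show "i div n < g" "i mod n < n" using div_mod_less[OF i(1)] by auto
    show "b (i div n) (i mod n) \<noteq> 0" using i(2) by (simp add: b_def)
    fix j v assume j: "j \<in> set js" and v: "v \<in> carrier_vec (dj j * n)"
      and "lin_pencil (dj j) n (Aj j) X *\<^sub>v v = 0\<^sub>v (dj j * n)"
    then obtain c where c: "c \<in> carrier_vec (kj j)" "v = Z j *\<^sub>v c" using gen[OF j v] by (auto simp: L_def)
    have "pencil_border g (dj j) n (Aj j) b *\<^sub>v col (Z j) s = 0\<^sub>v (dj j)" if s: "s < kj j" for s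
      unfolding b_def
    proof (rule pencil_border_eq_zero_linear)
      show "col (Z j) s \<in> carrier_vec (dj j * n)" using Zc[OF j] by (metis carrier_matD(1) col_dim)
      fix q assume "q < dj j"
      then have "R j s q \<in> set rs" using j s by (auto simp: rs_def intro!: bexI[of _ j])
      then show "vec (g * n) (\<lambda>i. \<Sum>p<dj j. Aj j ! (i div n) $$ (q, p) * col (Z j) s $ (p * n + i mod n)) \<bullet> x = 0"
        using x(3) unfolding R_def by blast
    qed (rule x(1))
    then show "pencil_border g (dj j) n (Aj j) b *\<^sub>v v = 0\<^sub>v (dj j)"
      unfolding c(2) using pencil_border_mult_zero_on_span[OF Zc[OF j] _ c(1)] by blast
  qed
qed

text \<open>
  One scaling factor serves all summands at once, because there are finitely many of them.
\<close>

lemma pencil_border_dominated_small_scale: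
  assumes A: "\<And>j. j \<in> set js \<Longrightarrow> Aj j \<in> sym_tuples g (dj j)" and X: "X \<in> sym_tuples g n"
    and psd: "\<And>j. j \<in> set js \<Longrightarrow> psd_mat (lin_pencil (dj j) n (Aj j) X)"
    and ker: "\<And>j v. j \<in> set js \<Longrightarrow> v \<in> carrier_vec (dj j * n) \<Longrightarrow>
      lin_pencil (dj j) n (Aj j) X *\<^sub>v v = 0\<^sub>v (dj j * n) \<Longrightarrow> pencil_border g (dj j) n (Aj j) b *\<^sub>v v = 0\<^sub>v (dj j)"
  obtains \<epsilon> :: real where "\<epsilon> > 0"
    "\<And>j. j \<in> set js \<Longrightarrow> psd_mat (lin_pencil (dj j) (n + 1) (Aj j) (column_dilation g n X (\<lambda>k r. \<epsilon> * b k r)))"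
proof -
  define L N where "L j = lin_pencil (dj j) n (Aj j) X" and "N j = pencil_border g (dj j) n (Aj j) b" for j
  have Lc: "L j \<in> carrier_mat (dj j * n) (dj j * n)" if "j \<in> set js" for j
    unfolding L_def by (rule lin_pencil_sym_carrier[OF A[OF that] X])
  have Nc: "N j \<in> carrier_mat (dj j) (dj j * n)" for j unfolding N_def by (rule pencil_border_carrier)
  have "\<exists>C\<ge>0. \<forall>u\<in>carrier_vec (dj j * n). (N j *\<^sub>v u) \<bullet> (N j *\<^sub>v u) \<le> C * (u \<bullet> (L j *\<^sub>v u))"
    if j: "j \<in> set js" for j
    by (rule psd_mat_dominates[OF psd[OF j, folded L_def] Lc[OF j] Nc ker[OF j, folded L_def N_def]]) blast+
  then obtain C where C: "\<And>j. j \<in> set js \<Longrightarrow> C j \<ge> 0"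
    "\<And>j u. j \<in> set js \<Longrightarrow> u \<in> carrier_vec (dj j * n) \<Longrightarrow> (N j *\<^sub>v u) \<bullet> (N j *\<^sub>v u) \<le> C j * (u \<bullet> (L j *\<^sub>v u))"
    by metis
  define S where "S = (\<Sum>j\<in>set js. C j)"
  have S0: "S \<ge> 0" unfolding S_def by (intro sum_nonneg C(1))
  have CS: "C j \<le> S" if "j \<in> set js" for j
    unfolding S_def using that C(1) by (intro member_le_sum) auto
  \<comment> \<open>The border enters quadratically, so \<open>\<epsilon>\<^sup>2 S \<le> 1\<close> is what is needed; the summand one covers \<open>S = 0\<close>.\<close>
  define \<epsilon> where "\<epsilon> = 1 / (S + 1)"
  have \<epsilon>: "\<epsilon> > 0" "\<epsilon> * S \<le> 1" "\<epsilon> \<le> 1" using S0 by (auto simp: \<epsilon>_def)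
  show thesis
  proof (rule that[OF \<epsilon>(1)])
    fix j assume j: "j \<in> set js"
    show "psd_mat (lin_pencil (dj j) (n + 1) (Aj j) (column_dilation g n X (\<lambda>k r. \<epsilon> * b k r)))"
    proof (rule psd_lin_pencil_column_dilation[OF A[OF j] X])
      fix u :: "real vec" assume u: "u \<in> carrier_vec (dj j * n)"
      have q0: "u \<bullet> (L j *\<^sub>v u) \<ge> 0" using psd[OF j] u Lc[OF j] by (simp add: psd_mat_def L_def)
      have Nu: "N j *\<^sub>v u \<in> carrier_vec (dj j)" using Nc[of j] u by simp
      have "(\<epsilon> \<cdot>\<^sub>m N j *\<^sub>v u) \<bullet> (\<epsilon> \<cdot>\<^sub>m N j *\<^sub>v u) = (\<epsilon> * \<epsilon>) * ((N j *\<^sub>v u) \<bullet> (N j *\<^sub>v u))"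
      proof -
        have "\<epsilon> \<cdot>\<^sub>m N j *\<^sub>v u = \<epsilon> \<cdot>\<^sub>v (N j *\<^sub>v u)" using Nc[of j] u by (intro eq_vecI) auto
        then show ?thesis using Nu by simp
      qed
      also have "\<dots> \<le> (\<epsilon> * \<epsilon>) * (S * (u \<bullet> (L j *\<^sub>v u)))"
        using C(2)[OF j u] mult_right_mono[OF CS[OF j] q0] \<epsilon>(1) by (intro mult_left_mono) auto
      also have "\<dots> = (\<epsilon> * (\<epsilon> * S)) * (u \<bullet> (L j *\<^sub>v u))" by simp
      also have "\<dots> \<le> 1 * (u \<bullet> (L j *\<^sub>v u))"
        using mult_le_one[OF \<epsilon>(3) _ \<epsilon>(2)] \<epsilon>(1) S0 q0 by (intro mult_right_mono) auto
      finally show "(pencil_border g (dj j) n (Aj j) (\<lambda>k r. \<epsilon> * b k r) *\<^sub>v u) \<bullet>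
          (pencil_border g (dj j) n (Aj j) (\<lambda>k r. \<epsilon> * b k r) *\<^sub>v u) \<le> u \<bullet> (lin_pencil (dj j) n (Aj j) X *\<^sub>v u)"
        unfolding pencil_border_scale N_def L_def by simp
    qed
  qed
qed

text \<open>
  If the bound failed, there would be a nonzero border that can be scaled so that all summands of the
  pencil of the dilated tuple are positive semidefinite, contradicting extremality.
\<close>

theorem arveson_extreme_point_kernel_bound:
  assumes A: "A \<in> sym_tuples g d"
    and Aj: "\<And>j. j \<in> set js \<Longrightarrow> Aj j \<in> sym_tuples g (dj j)"
    and eq: "unitarily_equivalent d A (tuple_direct_sum g (map Aj js))"
    and arv: "arveson_extreme_point g d A n X"
  shows "g * n \<le> (\<Sum>j\<leftarrow>js. dj j * kernel_dim (lin_pencil (dj j) n (Aj j) X))"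
proof (cases "g = 0")
  case False
  define B s where "B = tuple_direct_sum g (map Aj js)" and "s = (\<Sum>j\<leftarrow>js. dj j)"
  have B: "B \<in> sym_tuples g s" unfolding B_def s_def by (rule tuple_direct_sum_sym[OF Aj])
  have s: "s = d"
  proof -
    obtain U where U: "U \<in> carrier_mat d d" "map (\<lambda>M. U\<^sup>T * M * U) A = B"
      using eq by (auto simp: unitarily_equivalent_def B_def)
    have "B ! 0 = U\<^sup>T * (A ! 0) * U" using U(2) False sym_tuplesD(1)[OF A] by auto
    then have "dim_row (B ! 0) = d" using U(1) by simp
    then show ?thesis using sym_tuplesD(2)[OF B, of 0] False by simp
  qed
  have level: "psd_mat (lin_pencil d m A Y) \<longleftrightarrow> (\<forall>j\<in>set js. psd_mat (lin_pencil (dj j) m (Aj j) Y))"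
    if Y: "Y \<in> sym_tuples g m" for m Y
    using unitarily_equivalent_lin_pencil(1)[OF eq A Y] psd_lin_pencil_direct_sum[of js Aj g dj Y m, OF Aj Y]
    by (simp add: s[unfolded s_def])
  have X: "X \<in> sym_tuples g n" and psd: "psd_mat (lin_pencil d n A X)"
    using arv by (auto simp: arveson_extreme_point_def spectrahedron_level_def)
  have psdj: "psd_mat (lin_pencil (dj j) n (Aj j) X)" if "j \<in> set js" for j
    using level[OF X] psd that by blast
  show ?thesis
  proof (rule ccontr)
    assume "\<not> ?thesis"
    then have less: "(\<Sum>j\<leftarrow>js. dj j * kernel_dim (lin_pencil (dj j) n (Aj j) X)) < g * n" by simp
    obtain k r b where b: "k < g" "r < n" "b k r \<noteq> 0"
      and ker: "\<And>j v. j \<in> set js \<Longrightarrow> v \<in> carrier_vec (dj j * n) \<Longrightarrow>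
        lin_pencil (dj j) n (Aj j) X *\<^sub>v v = 0\<^sub>v (dj j * n) \<Longrightarrow> pencil_border g (dj j) n (Aj j) b *\<^sub>v v = 0\<^sub>v (dj j)"
      by (rule dilation_direction_exists[of js Aj g dj X n, OF Aj X less]) blast+
    obtain \<epsilon> :: real where \<epsilon>: "\<epsilon> > 0" and dil: "\<And>j. j \<in> set js \<Longrightarrow>
        psd_mat (lin_pencil (dj j) (n + 1) (Aj j) (column_dilation g n X (\<lambda>k r. \<epsilon> * b k r)))"
      by (rule pencil_border_dominated_small_scale[of js Aj g dj X n b, OF Aj X psdj ker]) blast+
    define \<beta> where "\<beta> = map (\<lambda>k. mat n 1 (\<lambda>(r, _). \<epsilon> * b k r)) [0..<g]"
    define \<gamma> where "\<gamma> = replicate g (0\<^sub>m 1 1 :: real mat)"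
    define Y where "Y = column_dilation g n X (\<lambda>k r. \<epsilon> * b k r)"
    have Y: "Y = block_tuple g X \<beta> \<gamma>" by (simp add: Y_def column_dilation_def \<beta>_def \<gamma>_def)
    have Ys: "Y \<in> sym_tuples g (n + 1)" unfolding Y_def by (rule column_dilation_sym[OF X])
    have "psd_mat (lin_pencil d (n + 1) A Y)" using level[OF Ys] dil by (simp add: Y_def)
    then have "Y \<in> spectrahedron_level g d A (n + 1)" using Ys by (simp add: spectrahedron_level_def)
    then have "Y \<in> free_spectrahedron g d A" unfolding free_spectrahedron_def
      by (intro UN_I[of "n + 1"]) auto
    moreover have "(0\<^sub>m 1 1)\<^sup>T = (0\<^sub>m 1 1 :: real mat)" by (intro eq_matI) auto
    then have "\<gamma> \<in> sym_tuples g 1" by (auto simp: \<gamma>_def sym_tuples_def)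
    moreover have "length \<beta> = g" "set \<beta> \<subseteq> carrier_mat n 1" by (auto simp: \<beta>_def)
    ultimately have "\<forall>M\<in>set \<beta>. M = 0\<^sub>m n 1"
      using arv unfolding arveson_extreme_point_def Y by blast
    then have "mat n 1 (\<lambda>(r, _). \<epsilon> * b k r) = 0\<^sub>m n 1" using b(1) by (simp add: \<beta>_def)
    then have "mat n 1 (\<lambda>(r, _). \<epsilon> * b k r) $$ (r, 0) = 0\<^sub>m n 1 $$ (r, 0)" by simp
    then show False using b \<epsilon> by simp
  qed
qed simp

section \<open>Facets of level one and joint eigenvalues\<close>

text \<open>
  A tuple of numbers plays two roles: as a defining tuple of size one it is the normal of a
  half-space, and as a point of level one it is a vector of \<open>\<real>\<^sup>g\<close>.
\<close>

definition scalar_tuple :: "nat \<Rightarrow> (nat \<Rightarrow> real) \<Rightarrow> real mat list" where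
  "scalar_tuple g c = map (\<lambda>k. mat 1 1 (\<lambda>_. c k)) [0..<g]"

lemma scalar_tuple_sym: "scalar_tuple g c \<in> sym_tuples g 1"
  unfolding scalar_tuple_def by (intro sym_tuples_mapI eq_matI) auto

lemma index_scalar_tuple: "k < g \<Longrightarrow> scalar_tuple g c ! k $$ (0, 0) = c k"
  by (simp add: scalar_tuple_def)

lemma index_lin_pencil_scalar_left:
  assumes X: "X \<in> sym_tuples g n" and v: "v \<in> carrier_vec n" and r: "r < n"
  shows "(lin_pencil 1 n (scalar_tuple g c) X *\<^sub>v v) $ r = v $ r - (\<Sum>k<g. c k * (X ! k *\<^sub>v v) $ r)"
proof -
  have "(X ! k *\<^sub>v v) $ r = (\<Sum>s<n. X ! k $$ (r, s) * v $ s)" if "k < g" for k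
    using sym_tuplesD(2)[OF X that] v r by (simp add: scalar_prod_def atLeast0LessThan)
  then show ?thesis
    using index_lin_pencil_mult_vec[OF scalar_tuple_sym[of g c] X, of v 0 r] v r
    by (simp add: index_scalar_tuple sum_distrib_left mult.assoc del: index_mult_mat_vec)
qed

lemma index_lin_pencil_scalar_right:
  assumes A: "A \<in> sym_tuples g d" and v: "v \<in> carrier_vec d" and p: "p < d"
  shows "(lin_pencil d 1 A (scalar_tuple g x) *\<^sub>v v) $ p = v $ p - (\<Sum>k<g. x k * (A ! k *\<^sub>v v) $ p)"
proof -
  have "(A ! k *\<^sub>v v) $ p = (\<Sum>s<d. A ! k $$ (p, s) * v $ s)" if "k < g" for k
    using sym_tuplesD(2)[OF A that] v p by (simp add: scalar_prod_def atLeast0LessThan)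
  then show ?thesis
    using index_lin_pencil_mult_vec[OF A scalar_tuple_sym[of g x], of v p 0] v p
    by (simp add: index_scalar_tuple sum_distrib_left mult.assoc mult.left_commute del: index_mult_mat_vec)
qed

text \<open>
  Common to the two sides on which a scalar tuple can enter a pencil.
\<close>

lemma quadratic_form_from_entries:
  assumes v: "(v :: real vec) \<in> carrier_vec m" and w: "w \<in> carrier_vec m"
    and Y: "\<And>k. k < g \<Longrightarrow> Y k \<in> carrier_vec m"
    and e: "\<And>r. r < m \<Longrightarrow> w $ r = v $ r - (\<Sum>k<g. c k * Y k $ r)"
  shows "v \<bullet> w = v \<bullet> v - (\<Sum>k<g. c k * (v \<bullet> Y k))"
proof -
  have "v \<bullet> w = (\<Sum>r<m. v $ r * w $ r)" using w by (simp add: scalar_prod_def atLeast0LessThan)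
  also have "\<dots> = (\<Sum>r<m. v $ r * v $ r) - (\<Sum>r<m. \<Sum>k<g. c k * (v $ r * Y k $ r))"
    unfolding sum_subtractf[symmetric]
    by (intro sum.cong refl) (simp add: e sum_distrib_left algebra_simps)
  also have "(\<Sum>r<m. \<Sum>k<g. c k * (v $ r * Y k $ r)) = (\<Sum>k<g. \<Sum>r<m. c k * (v $ r * Y k $ r))"
    by (rule sum.swap)
  also have "\<dots> = (\<Sum>k<g. c k * (v \<bullet> Y k))"
  proof (rule sum.cong[OF refl])
    fix k assume "k \<in> {..<g}"
    then have "dim_vec (Y k) = m" using Y by auto
    then show "(\<Sum>r<m. c k * (v $ r * Y k $ r)) = c k * (v \<bullet> Y k)"
      by (simp add: scalar_prod_def atLeast0LessThan sum_distrib_left)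
  qed
  finally show ?thesis using v by (simp add: scalar_prod_def atLeast0LessThan)
qed

lemma quadratic_form_lin_pencil_scalar_left:
  assumes X: "X \<in> sym_tuples g n" and v: "v \<in> carrier_vec n"
  shows "v \<bullet> (lin_pencil 1 n (scalar_tuple g c) X *\<^sub>v v) = v \<bullet> v - (\<Sum>k<g. c k * (v \<bullet> (X ! k *\<^sub>v v)))"
proof (rule quadratic_form_from_entries[OF v])
  show "lin_pencil 1 n (scalar_tuple g c) X *\<^sub>v v \<in> carrier_vec n"
    using lin_pencil_sym_carrier[OF scalar_tuple_sym[of g c] X] v by simp
  show "X ! k *\<^sub>v v \<in> carrier_vec n" if "k < g" for k using sym_tuplesD(2)[OF X that] v by simp
qed (rule index_lin_pencil_scalar_left[OF X v])

lemma quadratic_form_lin_pencil_scalar_right: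
  assumes A: "A \<in> sym_tuples g d" and v: "v \<in> carrier_vec d"
  shows "v \<bullet> (lin_pencil d 1 A (scalar_tuple g x) *\<^sub>v v) = v \<bullet> v - (\<Sum>k<g. x k * (v \<bullet> (A ! k *\<^sub>v v)))"
proof (rule quadratic_form_from_entries[OF v])
  show "lin_pencil d 1 A (scalar_tuple g x) *\<^sub>v v \<in> carrier_vec d"
    using lin_pencil_sym_carrier[OF A scalar_tuple_sym[of g x]] v by simp
  show "A ! k *\<^sub>v v \<in> carrier_vec d" if "k < g" for k using sym_tuplesD(2)[OF A that] v by simp
qed (rule index_lin_pencil_scalar_right[OF A v])

lemma psd_lin_pencil_iff:
  assumes A: "A \<in> sym_tuples g d" and X: "X \<in> sym_tuples g n"
  shows "psd_mat (lin_pencil d n A X) \<longleftrightarrow> (\<forall>v\<in>carrier_vec (d * n). v \<bullet> (lin_pencil d n A X *\<^sub>v v) \<ge> 0)"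
  using lin_pencil_sym_carrier[OF A X] transpose_lin_pencil[OF A X] by (auto simp: psd_mat_def)

lemma psd_lin_pencil_scalar_scalar:
  "psd_mat (lin_pencil 1 1 (scalar_tuple g c) (scalar_tuple g x)) \<longleftrightarrow> (\<Sum>k<g. c k * x k) \<le> 1"
proof -
  have q: "v \<bullet> (lin_pencil 1 1 (scalar_tuple g c) (scalar_tuple g x) *\<^sub>v v) = (1 - (\<Sum>k<g. c k * x k)) * (v $ 0)\<^sup>2"
    if v: "v \<in> carrier_vec 1" for v
  proof -
    have "v \<bullet> v = (v $ 0)\<^sup>2" using v by (simp add: scalar_prod_def power2_eq_square)
    moreover have "v \<bullet> (scalar_tuple g x ! k *\<^sub>v v) = x k * (v $ 0)\<^sup>2" if "k < g" for k
      using v that by (simp add: scalar_prod_def scalar_tuple_def power2_eq_square)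
    ultimately show ?thesis unfolding quadratic_form_lin_pencil_scalar_left[OF scalar_tuple_sym v]
      by (simp add: left_diff_distrib sum_distrib_right mult.assoc)
  qed
  show ?thesis
  proof
    assume psd: "psd_mat (lin_pencil 1 1 (scalar_tuple g c) (scalar_tuple g x))"
    define e where "e = vec 1 (\<lambda>_. 1 :: real)"
    have e: "e \<in> carrier_vec 1" "e $ 0 = 1" by (auto simp: e_def)
    then have "e \<bullet> (lin_pencil 1 1 (scalar_tuple g c) (scalar_tuple g x) *\<^sub>v e) \<ge> 0"
      using psd unfolding psd_lin_pencil_iff[OF scalar_tuple_sym scalar_tuple_sym] by simp
    then show "(\<Sum>k<g. c k * x k) \<le> 1" using q[OF e(1)] e(2) by simp
  next
    assume "(\<Sum>k<g. c k * x k) \<le> 1"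
    then show "psd_mat (lin_pencil 1 1 (scalar_tuple g c) (scalar_tuple g x))"
      unfolding psd_lin_pencil_iff[OF scalar_tuple_sym scalar_tuple_sym] mult_1
      by (intro ballI) (simp only: q, simp)
  qed
qed

lemma exists_common_small_step:
  fixes a s :: "'i \<Rightarrow> real"
  assumes "finite I" "\<And>i. i \<in> I \<Longrightarrow> s i > 0"
  obtains \<epsilon> where "\<epsilon> > 0" "\<And>i. i \<in> I \<Longrightarrow> \<epsilon> * \<bar>a i\<bar> \<le> s i"
proof -
  define \<delta> where "\<delta> i = s i / (\<bar>a i\<bar> + 1)" for i
  define \<epsilon> where "\<epsilon> = Min (insert 1 (\<delta> ` I))"
  have pos: "\<delta> i > 0" if "i \<in> I" for i using assms(2)[OF that] by (simp add: \<delta>_def)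
  have le: "\<epsilon> \<le> \<delta> i" if "i \<in> I" for i using assms(1) that by (auto simp: \<epsilon>_def)
  show thesis
  proof (rule that)
    show "\<epsilon> > 0" using assms(1) pos by (auto simp: \<epsilon>_def)
    fix i assume i: "i \<in> I"
    have "\<epsilon> * \<bar>a i\<bar> \<le> \<delta> i * \<bar>a i\<bar>" using le[OF i] by (rule mult_right_mono) simp
    also have "\<dots> \<le> \<delta> i * (\<bar>a i\<bar> + 1)" using pos[OF i] by simp
    also have "\<dots> = s i" by (simp add: \<delta>_def)
    finally show "\<epsilon> * \<bar>a i\<bar> \<le> s i" .
  qed
qed

text \<open>
  A positive definite \<open>L\<^sub>A(x)\<close> would dominate a multiple of the identity, and then \<open>x\<close> could be pushed
  further away from the origin.
\<close>

lemma boundary_point_pencil_singular: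
  assumes A: "A \<in> sym_tuples g d" and psd: "psd_mat (lin_pencil d 1 A (scalar_tuple g x))"
    and out: "\<And>t. t > 1 \<Longrightarrow> \<not> psd_mat (lin_pencil d 1 A (scalar_tuple g (\<lambda>k. t * x k)))"
  obtains v where "v \<in> carrier_vec d" "v \<noteq> 0\<^sub>v d" "lin_pencil d 1 A (scalar_tuple g x) *\<^sub>v v = 0\<^sub>v d"
proof -
  define P where "P x = lin_pencil d 1 A (scalar_tuple g x)" for x
  have Pc: "P x \<in> carrier_mat d d" for x
    using lin_pencil_sym_carrier[OF A scalar_tuple_sym[of g x]] by (simp add: P_def)
  have "\<exists>v\<in>carrier_vec d. v \<noteq> 0\<^sub>v d \<and> P x *\<^sub>v v = 0\<^sub>v d"
  proof (rule ccontr)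
    assume "\<not> ?thesis"
    then have inj: "1\<^sub>m d *\<^sub>v v = 0\<^sub>v d" if "v \<in> carrier_vec d" "P x *\<^sub>v v = 0\<^sub>v d" for v
      using that by auto
    obtain C where C: "C \<ge> 0"
      "\<And>u. u \<in> carrier_vec d \<Longrightarrow> (1\<^sub>m d *\<^sub>v u) \<bullet> (1\<^sub>m d *\<^sub>v u) \<le> C * (u \<bullet> (P x *\<^sub>v u))"
      using psd_mat_dominates[OF psd[folded P_def] Pc one_carrier_mat inj] by blast
    define \<epsilon> where "\<epsilon> = 1 / (C + 1)"
    have \<epsilon>: "\<epsilon> > 0" "\<epsilon> * C \<le> 1" using C(1) by (auto simp: \<epsilon>_def)
    have "u \<bullet> (P (\<lambda>k. (1 + \<epsilon>) * x k) *\<^sub>v u) \<ge> 0" if u: "u \<in> carrier_vec d" for u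
    proof -
      define q where "q = u \<bullet> (P x *\<^sub>v u)"
      have q: "q = u \<bullet> u - (\<Sum>k<g. x k * (u \<bullet> (A ! k *\<^sub>v u)))"
        unfolding q_def P_def by (rule quadratic_form_lin_pencil_scalar_right[OF A u])
      have q0: "q \<ge> 0" using psd u Pc[of x] by (simp add: q_def P_def psd_mat_def)
      have uu: "u \<bullet> u \<le> C * q" using C(2)[OF u] u by (simp add: q_def)
      have "u \<bullet> (P (\<lambda>k. (1 + \<epsilon>) * x k) *\<^sub>v u) = u \<bullet> u - (1 + \<epsilon>) * (\<Sum>k<g. x k * (u \<bullet> (A ! k *\<^sub>v u)))"
        unfolding P_def quadratic_form_lin_pencil_scalar_right[OF A u] by (simp add: sum_distrib_left mult.assoc)
      also have "\<dots> = (1 + \<epsilon>) * q - \<epsilon> * (u \<bullet> u)" by (simp add: q algebra_simps)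
      also have "\<dots> \<ge> (1 + \<epsilon>) * q - \<epsilon> * (C * q)" using uu \<epsilon>(1) by simp
      moreover have "\<epsilon> * (C * q) \<le> q" using mult_right_mono[OF \<epsilon>(2) q0] by simp
      moreover have "\<epsilon> * q \<ge> 0" using \<epsilon>(1) q0 by simp
      ultimately show ?thesis by (simp add: distrib_right)
    qed
    then have "psd_mat (P (\<lambda>k. (1 + \<epsilon>) * x k))"
      unfolding P_def psd_lin_pencil_iff[OF A scalar_tuple_sym] by simp
    then show False using out[of "1 + \<epsilon>"] \<epsilon>(1) by (simp add: P_def)
  qed
  then show thesis using that unfolding P_def by blast
qed

text \<open>
  The form of the pencil at \<open>v\<close> is affine along the line through \<open>x\<close> with direction \<open>u\<close>, vanishes
  at \<open>x\<close> and is nonnegative on both sides. So it is zero on the segment, \<open>v\<close> lies in the kernel of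
  the positive semidefinite pencil at \<open>x + \<epsilon> u\<close> too, and the difference of the two kernel equations is the
  claim.
\<close>

lemma pencil_kernel_vector_constant_along:
  assumes A: "A \<in> sym_tuples g d" and v: "v \<in> carrier_vec d"
    and ker: "lin_pencil d 1 A (scalar_tuple g x) *\<^sub>v v = 0\<^sub>v d" and \<epsilon>: "\<epsilon> > 0"
    and plus: "psd_mat (lin_pencil d 1 A (scalar_tuple g (\<lambda>k. x k + \<epsilon> * u k)))"
    and minus: "psd_mat (lin_pencil d 1 A (scalar_tuple g (\<lambda>k. x k - \<epsilon> * u k)))"
    and p: "p < d"
  shows "(\<Sum>k<g. u k * (A ! k *\<^sub>v v) $ p) = 0"
proof -
  define a where "a = (\<Sum>k<g. u k * (v \<bullet> (A ! k *\<^sub>v v)))"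
  have "v \<bullet> v - (\<Sum>k<g. x k * (v \<bullet> (A ! k *\<^sub>v v))) = 0"
    using quadratic_form_lin_pencil_scalar_right[OF A v, of x] ker v by simp
  then have q: "v \<bullet> (lin_pencil d 1 A (scalar_tuple g (\<lambda>k. x k + t * u k)) *\<^sub>v v) = - t * a" for t
    unfolding quadratic_form_lin_pencil_scalar_right[OF A v] a_def
    by (simp add: sum.distrib sum_distrib_left sum_negf algebra_simps)
  have car: "lin_pencil d 1 A (scalar_tuple g y) \<in> carrier_mat d d" for y
    using lin_pencil_sym_carrier[OF A scalar_tuple_sym[of g y]] by simp
  have "- \<epsilon> * a \<ge> 0" using psd_mat_nonneg[OF plus car v] unfolding q .
  moreover have "\<epsilon> * a \<ge> 0" using psd_mat_nonneg[OF minus car v] q[of "- \<epsilon>"] by simp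
  ultimately have "v \<bullet> (lin_pencil d 1 A (scalar_tuple g (\<lambda>k. x k + \<epsilon> * u k)) *\<^sub>v v) = 0"
    using q[of \<epsilon>] by simp
  then have "lin_pencil d 1 A (scalar_tuple g (\<lambda>k. x k + \<epsilon> * u k)) *\<^sub>v v = 0\<^sub>v d"
    using psd_mat_kernelI[OF plus car v] by simp
  then have "v $ p - (\<Sum>k<g. (x k + \<epsilon> * u k) * (A ! k *\<^sub>v v) $ p) = 0"
    using index_lin_pencil_scalar_right[OF A v p, of "\<lambda>k. x k + \<epsilon> * u k"] p by (simp del: index_mult_mat_vec)
  moreover have "v $ p - (\<Sum>k<g. x k * (A ! k *\<^sub>v v) $ p) = 0"
    using index_lin_pencil_scalar_right[OF A v p, of x] ker p by (simp del: index_mult_mat_vec)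
  ultimately have "\<epsilon> * (\<Sum>k<g. u k * (A ! k *\<^sub>v v) $ p) = 0"
    by (simp add: sum.distrib sum_distrib_left algebra_simps del: index_mult_mat_vec)
  then show ?thesis using \<epsilon> by simp
qed

text \<open>
  The \<open>j\<close>-th inequality defines a facet because \<open>y\<close> violates it and no other. Scaling \<open>y\<close> down until
  the \<open>j\<close>-th inequality becomes an equality makes all the others strict.
\<close>

lemma facet_normal_joint_eigenvalue:
  fixes b :: "nat \<Rightarrow> nat \<Rightarrow> real"
  assumes A: "A \<in> sym_tuples g d"
    and polytope: "\<And>x. psd_mat (lin_pencil d 1 A (scalar_tuple g x)) \<longleftrightarrow> (\<forall>i<m. (\<Sum>k<g. b i k * x k) \<le> 1)"
    and j: "j < m" and yj: "(\<Sum>k<g. b j k * y k) > 1"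
    and yi: "\<And>i. i < m \<Longrightarrow> i \<noteq> j \<Longrightarrow> (\<Sum>k<g. b i k * y k) \<le> 1"
  obtains v where "v \<in> carrier_vec d" "v \<noteq> 0\<^sub>v d" "\<And>k. k < g \<Longrightarrow> A ! k *\<^sub>v v = b j k \<cdot>\<^sub>v v"
proof -
  define ip where "ip c x = (\<Sum>k<g. c k * x k)" for c x :: "nat \<Rightarrow> real"
  have ip_scale: "ip c (\<lambda>k. t * x k) = t * ip c x" for c t x
    by (simp add: ip_def sum_distrib_left algebra_simps)
  have ip_add: "ip c (\<lambda>k. x k + t * u k) = ip c x + t * ip c u" for c t x u
    by (simp add: ip_def sum.distrib sum_distrib_left algebra_simps)
  have ip_sub: "ip c (\<lambda>k. x k - t * u k) = ip c x - t * ip c u" for c t x u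
    by (simp add: ip_def sum_subtractf sum_distrib_left algebra_simps)
  \<comment> \<open>The point where the segment from the origin to \<open>y\<close> crosses the \<open>j\<close>-th hyperplane.\<close>
  define s where "s = ip (b j) y"
  have s: "s > 1" using yj by (simp add: s_def ip_def)
  define x where "x = (\<lambda>k. (1 / s) * y k)"
  have xj: "ip (b j) x = 1" unfolding x_def ip_scale using s by (simp add: s_def)
  have xi: "ip (b i) x < 1" if "i < m" "i \<noteq> j" for i
  proof -
    have "ip (b i) x = ip (b i) y / s" unfolding x_def ip_scale by simp
    also have "\<dots> \<le> 1 / s" using yi[OF that] s by (intro divide_right_mono) (auto simp: ip_def)
    also have "\<dots> < 1" using s by simp
    finally show ?thesis .
  qed
  have psd: "psd_mat (lin_pencil d 1 A (scalar_tuple g z)) \<longleftrightarrow> (\<forall>i<m. ip (b i) z \<le> 1)" for z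
    unfolding polytope ip_def ..
  have psdx: "psd_mat (lin_pencil d 1 A (scalar_tuple g x))"
    unfolding psd using xj xi by (metis less_eq_real_def)
  have out: "\<not> psd_mat (lin_pencil d 1 A (scalar_tuple g (\<lambda>k. t * x k)))" if "t > 1" for t
    unfolding psd ip_scale using xj j that by (auto intro!: exI[of _ j])
  obtain v where v: "v \<in> carrier_vec d" "v \<noteq> 0\<^sub>v d" and ker: "lin_pencil d 1 A (scalar_tuple g x) *\<^sub>v v = 0\<^sub>v d"
    using boundary_point_pencil_singular[OF A psdx out] by blast
  have "A ! k *\<^sub>v v = b j k \<cdot>\<^sub>v v" if k: "k < g" for k
  proof (rule eq_vecI)
    fix p assume "p < dim_vec (b j k \<cdot>\<^sub>v v)"
    then have p: "p < d" using v by simp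
    \<comment> \<open>The \<open>k\<close>-th unit vector, corrected by a multiple of \<open>x\<close> to be parallel to the facet.\<close>
    define u where "u i = (if i = k then 1 else 0) - b j k * x i" for i
    have uj: "ip (b j) u = 0"
    proof -
      have "ip (b j) u = ip (b j) (\<lambda>i. if i = k then 1 else 0) - b j k * ip (b j) x"
        unfolding u_def by (rule ip_sub)
      also have "ip (b j) (\<lambda>i. if i = k then 1 else 0) = b j k"
        using k by (simp add: ip_def if_distrib cong: if_cong)
      finally show ?thesis using xj by simp
    qed
    obtain \<epsilon> where \<epsilon>: "\<epsilon> > 0" "\<And>i. i \<in> {..<m} - {j} \<Longrightarrow> \<epsilon> * \<bar>ip (b i) u\<bar> \<le> 1 - ip (b i) x"
    proof (rule exists_common_small_step[of "{..<m} - {j}" "\<lambda>i. 1 - ip (b i) x" "\<lambda>i. ip (b i) u"])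
      show "1 - ip (b i) x > 0" if "i \<in> {..<m} - {j}" for i using xi[of i] that by simp
    qed auto
    have near: "ip (b i) x + \<epsilon> * ip (b i) u \<le> 1 \<and> ip (b i) x - \<epsilon> * ip (b i) u \<le> 1" if i: "i < m" for i
    proof (cases "i = j")
      case False
      then have "\<bar>\<epsilon> * ip (b i) u\<bar> \<le> 1 - ip (b i) x" using \<epsilon>(1) \<epsilon>(2)[of i] i by (simp add: abs_mult)
      then show ?thesis by linarith
    qed (simp add: uj xj)
    have plus: "psd_mat (lin_pencil d 1 A (scalar_tuple g (\<lambda>k. x k + \<epsilon> * u k)))"
      and minus: "psd_mat (lin_pencil d 1 A (scalar_tuple g (\<lambda>k. x k - \<epsilon> * u k)))"
      unfolding psd ip_add ip_sub using near by blast+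
    have "0 = (\<Sum>i<g. u i * (A ! i *\<^sub>v v) $ p)"
      by (rule pencil_kernel_vector_constant_along[OF A v(1) ker \<epsilon>(1) plus minus p, symmetric])
    also have "\<dots> = (\<Sum>i<g. (if i = k then (A ! i *\<^sub>v v) $ p else 0)) - b j k * (\<Sum>i<g. x i * (A ! i *\<^sub>v v) $ p)"
      unfolding sum_distrib_left sum_subtractf[symmetric] u_def
      by (intro sum.cong refl) (simp add: algebra_simps del: index_mult_mat_vec)
    also have "(\<Sum>i<g. (if i = k then (A ! i *\<^sub>v v) $ p else 0)) = (A ! k *\<^sub>v v) $ p"
      using k by (simp del: index_mult_mat_vec)
    also have "(\<Sum>i<g. x i * (A ! i *\<^sub>v v) $ p) = v $ p"
      using index_lin_pencil_scalar_right[OF A v(1) p, of x] ker p by (simp del: index_mult_mat_vec)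
    finally show "(A ! k *\<^sub>v v) $ p = (b j k \<cdot>\<^sub>v v) $ p" using p v by (simp del: index_mult_mat_vec)
  qed (use sym_tuplesD(2)[OF A k] v in simp)
  with v show thesis by (rule that)
qed

section \<open>Diagonalization of minimal tuples of free polytopes\<close>

lemma diag_block_mat_scalars:
  "diag_block_mat (map (\<lambda>j. mat 1 1 (\<lambda>_. f j)) [0..<m]) = mat m m (\<lambda>(i, j). if i = j then f i else (0::real))"
proof (induction m)
  case 0
  then show ?case by (intro eq_matI) auto
next
  case (Suc m)
  have "diag_block_mat (map (\<lambda>j. mat 1 1 (\<lambda>_. f j)) [0..<Suc m]) =
      four_block_mat (mat m m (\<lambda>(i, j). if i = j then f i else 0)) (0\<^sub>m m 1) (0\<^sub>m 1 m) (mat 1 1 (\<lambda>_. f m))"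
    unfolding upt_Suc_append[OF le0] map_append list.map diag_block_mat_last Let_def Suc
      dim_row_mat dim_col_mat ..
  then show ?case by (auto intro!: eq_matI simp: less_Suc_eq)
qed

lemma tuple_direct_sum_scalar_tuples:
  "tuple_direct_sum g (map (\<lambda>j. scalar_tuple g (b j)) [0..<m]) =
    map (\<lambda>k. mat m m (\<lambda>(i, j). if i = j then b i k else 0)) [0..<g]"
  unfolding tuple_direct_sum_def
proof (rule map_cong[OF refl])
  fix k assume "k \<in> set [0..<g]"
  then have "map (\<lambda>B. B ! k) (map (\<lambda>j. scalar_tuple g (b j)) [0..<m]) = map (\<lambda>j. mat 1 1 (\<lambda>_. b j k)) [0..<m]"
    by (simp add: scalar_tuple_def)
  then show "diag_block_mat (map (\<lambda>B. B ! k) (map (\<lambda>j. scalar_tuple g (b j)) [0..<m])) =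
      mat m m (\<lambda>(i, j). if i = j then b i k else 0)"
    by (simp only: diag_block_mat_scalars)
qed

text \<open>
  Eigenvectors of a symmetric matrix for different eigenvalues are orthogonal; two of the joint
  eigenvalues \<open>b i\<close>, \<open>b j\<close> differ in some coordinate \<open>k\<close>, and \<open>A ! k\<close> separates the two vectors.
\<close>

lemma joint_eigenbasis_unitarily_equivalent:
  assumes A: "A \<in> sym_tuples g d"
    and v: "\<And>j. j < d \<Longrightarrow> v j \<in> carrier_vec d \<and> v j \<noteq> 0\<^sub>v d \<and> (\<forall>k<g. A ! k *\<^sub>v v j = b j k \<cdot>\<^sub>v v j)"
    and distinct: "\<And>i j. i < d \<Longrightarrow> j < d \<Longrightarrow> i \<noteq> j \<Longrightarrow> \<exists>k<g. b i k \<noteq> b j k"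
  shows "unitarily_equivalent d A (tuple_direct_sum g (map (\<lambda>j. scalar_tuple g (b j)) [0..<d]))"
proof -
  have orth: "v i \<bullet> v j = 0" if ij: "i < d" "j < d" "i \<noteq> j" for i j
  proof -
    obtain k where k: "k < g" "b i k \<noteq> b j k" using distinct[OF ij] by blast
    have vi: "v i \<in> carrier_vec d" and vj: "v j \<in> carrier_vec d" using v ij by auto
    have "b j k * (v i \<bullet> v j) = v i \<bullet> (A ! k *\<^sub>v v j)" using v[OF ij(2)] k(1) vi vj by simp
    also have "\<dots> = (A ! k *\<^sub>v v i) \<bullet> v j"
      by (rule symmetric_mat_scalar_prod[OF sym_tuplesD(2,3)[OF A k(1)] vi vj])
    also have "\<dots> = b i k * (v i \<bullet> v j)" using v[OF ij(1)] k(1) vi vj by simp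
    finally show ?thesis using k(2) by simp
  qed
  define w where "w j = (1 / sqrt (v j \<bullet> v j)) \<cdot>\<^sub>v v j" for j
  have w: "w j \<in> carrier_vec d" if "j < d" for j using v that by (simp add: w_def)
  have ww: "w i \<bullet> w j = (if i = j then 1 else 0)" if ij: "i < d" "j < d" for i j
  proof -
    have vi: "v i \<in> carrier_vec d" and vj: "v j \<in> carrier_vec d" using v ij by auto
    have e: "w i \<bullet> w j = v i \<bullet> v j / (sqrt (v i \<bullet> v i) * sqrt (v j \<bullet> v j))"
      using vi vj by (simp add: w_def)
    show ?thesis
    proof (cases "i = j")
      case True
      have "v i \<bullet> v i > 0" using scalar_prod_self_eq_0_iff[OF vi] scalar_prod_self_nonneg[of "v i"] v[OF ij(1)]
        by (simp add: less_eq_real_def)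
      then show ?thesis using e True by simp
    qed (simp add: e orth[OF ij])
  qed
  have Aw: "A ! k *\<^sub>v w j = b j k \<cdot>\<^sub>v w j" if "j < d" "k < g" for j k
  proof -
    have "A ! k *\<^sub>v w j = (1 / sqrt (v j \<bullet> v j)) \<cdot>\<^sub>v (A ! k *\<^sub>v v j)"
      unfolding w_def using v[OF that(1)] by (intro mult_mat_vec[OF sym_tuplesD(2)[OF A that(2)]]) simp
    then show ?thesis using v[OF that(1)] that(2) by (simp add: w_def smult_smult_assoc mult.commute)
  qed
  define U where "U = mat d d (\<lambda>(i, j). w j $ i)"
  have U: "U \<in> carrier_mat d d" by (simp add: U_def)
  have colU: "col U j = w j" if "j < d" for j using w[OF that] that by (intro eq_vecI) (auto simp: U_def)
  have UU: "U\<^sup>T * U = 1\<^sub>m d"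
    using U by (intro eq_matI) (auto simp: colU ww)
  have conj: "U\<^sup>T * (A ! k) * U = mat d d (\<lambda>(i, j). if i = j then b i k else 0)" if k: "k < g" for k
  proof (rule eq_matI)
    fix i j assume "i < dim_row (mat d d (\<lambda>(i, j). if i = j then b i k else (0::real)))"
      "j < dim_col (mat d d (\<lambda>(i, j). if i = j then b i k else (0::real)))"
    then have ij: "i < d" "j < d" by auto
    have Ak: "A ! k \<in> carrier_mat d d" by (rule sym_tuplesD(2)[OF A k])
    have UT: "U\<^sup>T \<in> carrier_mat d d" using U by simp
    have "(U\<^sup>T * (A ! k) * U) $$ (i, j) = (U\<^sup>T * (A ! k * U)) $$ (i, j)"
      unfolding assoc_mult_mat[OF UT Ak U] ..
    also have "\<dots> = w i \<bullet> (A ! k *\<^sub>v w j)"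
    proof -
      have "col (A ! k * U) j = A ! k *\<^sub>v w j" using col_mult2[OF Ak U ij(2)] colU[OF ij(2)] by simp
      then show ?thesis using ij U Ak by (simp add: colU)
    qed
    also have "\<dots> = (if i = j then b i k else 0)"
      unfolding Aw[OF ij(2) k] using w[OF ij(1)] w[OF ij(2)] by (simp add: ww[OF ij])
    finally show "(U\<^sup>T * (A ! k) * U) $$ (i, j) = mat d d (\<lambda>(i, j). if i = j then b i k else 0) $$ (i, j)"
      using ij by simp
  qed (use U in auto)
  have "map (\<lambda>M. U\<^sup>T * M * U) A = map (\<lambda>k. mat d d (\<lambda>(i, j). if i = j then b i k else 0)) [0..<g]"
    using sym_tuplesD(1)[OF A] conj by (intro nth_equalityI) auto
  then show ?thesis
    unfolding unitarily_equivalent_def tuple_direct_sum_scalar_tuples using U UU by blast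
qed

text \<open>
  A nonempty tuple determines its level, so membership in the union over all levels is membership in
  one of them; this is where \<open>g \<ge> 1\<close> enters.
\<close>

lemma free_spectrahedron_iff:
  assumes "g \<ge> 1" and X: "X \<in> sym_tuples g n" and "n \<ge> 1"
  shows "X \<in> free_spectrahedron g d A \<longleftrightarrow> psd_mat (lin_pencil d n A X)"
proof -
  have size: "m = n" if "X \<in> sym_tuples g m" for m
  proof -
    have "0 < g" using assms(1) by simp
    then show ?thesis using carrier_matD(1)[OF sym_tuplesD(2)[OF that]] carrier_matD(1)[OF sym_tuplesD(2)[OF X]]
      by simp
  qed
  show ?thesis
  proof
    assume "X \<in> free_spectrahedron g d A"
    then obtain m where m: "X \<in> sym_tuples g m" "psd_mat (lin_pencil d m A X)"
      unfolding free_spectrahedron_def spectrahedron_level_def by blast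
    show "psd_mat (lin_pencil d n A X)" using m(2) unfolding size[OF m(1)] .
  next
    assume "psd_mat (lin_pencil d n A X)"
    then have "X \<in> spectrahedron_level g d A n" using X unfolding spectrahedron_level_def by blast
    then show "X \<in> free_spectrahedron g d A"
      unfolding free_spectrahedron_def using \<open>n \<ge> 1\<close> by blast
  qed
qed

lemma diagonal_tuple_eq_direct_sum:
  assumes "length Y = g" and "\<And>k. k < g \<Longrightarrow> Y ! k \<in> carrier_mat d d" and "\<forall>M\<in>set Y. diagonal_mat M"
  shows "Y = tuple_direct_sum g (map (\<lambda>j. scalar_tuple g (\<lambda>k. Y ! k $$ (j, j))) [0..<d])"
proof (rule nth_equalityI)
  fix k assume "k < length Y"
  then have k: "k < g" using assms(1) by simp
  have "diagonal_mat (Y ! k)" using assms(1,3) k by simp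
  then have "Y ! k = mat d d (\<lambda>(i, j). if i = j then Y ! k $$ (i, i) else 0)"
    using assms(2)[OF k] by (intro eq_matI) (auto simp: diagonal_mat_def)
  moreover have "tuple_direct_sum g (map (\<lambda>j. scalar_tuple g (\<lambda>k. Y ! k $$ (j, j))) [0..<d]) ! k
      = mat d d (\<lambda>(i, j). if i = j then Y ! k $$ (i, i) else 0)"
    unfolding tuple_direct_sum_scalar_tuples using k by (simp cong: if_cong)
  ultimately show "Y ! k = tuple_direct_sum g (map (\<lambda>j. scalar_tuple g (\<lambda>k. Y ! k $$ (j, j))) [0..<d]) ! k"
    by (rule trans[OF _ sym])
qed (simp add: assms(1) tuple_direct_sum_def)

text \<open>
  The minimal diagonalizable tuple that witnesses the polytope property has the same size as \<open>A\<close>,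
  because both are minimal; its diagonal entries are the normals.
\<close>

lemma free_polytope_halfspaces:
  assumes g: "g \<ge> 1" and d: "d \<ge> 1" and min: "minimal_defining_tuple g d A"
    and poly: "free_polytope g (free_spectrahedron g d A)"
  obtains b where "\<And>n X. n \<ge> 1 \<Longrightarrow> X \<in> sym_tuples g n \<Longrightarrow>
    psd_mat (lin_pencil d n A X) \<longleftrightarrow> (\<forall>j<d. psd_mat (lin_pencil 1 n (scalar_tuple g (b j)) X))"
proof -
  have A: "A \<in> sym_tuples g d" using min by (simp add: minimal_defining_tuple_def)
  obtain d' B where d': "d' \<ge> 1" and minB: "minimal_defining_tuple g d' B"
    and eqD: "free_spectrahedron g d' B = free_spectrahedron g d A"
    and diag: "simultaneously_diagonalizable d' B"
    using poly by (auto simp: free_polytope_def)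
  have B: "B \<in> sym_tuples g d'" using minB by (simp add: minimal_defining_tuple_def)
  have "d \<le> d'" using min d' B eqD by (auto simp: minimal_defining_tuple_def)
  moreover have "d' \<le> d" using minB d A eqD by (auto simp: minimal_defining_tuple_def)
  ultimately have dd: "d' = d" by simp
  obtain Y where Y: "unitarily_equivalent d B Y" and Yd: "\<forall>M\<in>set Y. diagonal_mat M"
    using diag by (auto simp: simultaneously_diagonalizable_def dd)
  define b where "b j k = Y ! k $$ (j, j)" for j k
  have Bd: "B \<in> sym_tuples g d" using B by (simp add: dd)
  have Yeq: "Y = tuple_direct_sum g (map (\<lambda>j. scalar_tuple g (b j)) [0..<d])"
    unfolding b_def
  proof (rule diagonal_tuple_eq_direct_sum[OF _ _ Yd])
    obtain U where U: "U \<in> carrier_mat d d" "map (\<lambda>M. U\<^sup>T * M * U) B = Y"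
      using Y by (auto simp: unitarily_equivalent_def)
    then show "length Y = g" using sym_tuplesD(1)[OF Bd] by auto
    fix k assume k: "k < g"
    then have "Y ! k = U\<^sup>T * (B ! k) * U" using U(2) sym_tuplesD(1)[OF Bd] by auto
    then show "Y ! k \<in> carrier_mat d d" using U(1) sym_tuplesD(2)[OF Bd k] by simp
  qed
  show thesis
  proof (rule that[of b])
    fix n and X :: "real mat list" assume n: "n \<ge> 1" and X: "X \<in> sym_tuples g n"
    have sum: "(\<Sum>j\<leftarrow>[0..<d]. 1) = d" by (simp add: sum_list_triv)
    have "psd_mat (lin_pencil d n A X) \<longleftrightarrow> psd_mat (lin_pencil d n B X)"
      using free_spectrahedron_iff[OF g X n, of d A] free_spectrahedron_iff[OF g X n, of d B] eqD dd by simp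
    also have "\<dots> \<longleftrightarrow> psd_mat (lin_pencil d n Y X)"
      using unitarily_equivalent_lin_pencil(1)[OF Y Bd X] by simp
    also have "\<dots> \<longleftrightarrow> (\<forall>j<d. psd_mat (lin_pencil 1 n (scalar_tuple g (b j)) X))"
      unfolding Yeq
      using psd_lin_pencil_direct_sum[of "[0..<d]" "\<lambda>j. scalar_tuple g (b j)" g "\<lambda>_. 1" X n, OF scalar_tuple_sym X, unfolded sum]
      by auto
    finally show "psd_mat (lin_pencil d n A X) \<longleftrightarrow> (\<forall>j<d. psd_mat (lin_pencil 1 n (scalar_tuple g (b j)) X))" .
  qed
qed

text \<open>
  Omitting a redundant half-space would leave a defining tuple of size \<open>d - 1\<close>, which is positive as
  \<open>d \<ge> 2\<close>. So some matrix tuple \<open>X\<close> violates the \<open>j\<close>-th inequality only; compressing it to a vector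
  \<open>v\<close> on which the violation is visible gives a scalar point that does the same.
\<close>

lemma minimal_halfspace_irredundant:
  assumes g: "g \<ge> 1" and d: "d \<ge> 2" and min: "minimal_defining_tuple g d A"
    and half: "\<And>n X. n \<ge> 1 \<Longrightarrow> X \<in> sym_tuples g n \<Longrightarrow>
      psd_mat (lin_pencil d n A X) \<longleftrightarrow> (\<forall>j<d. psd_mat (lin_pencil 1 n (scalar_tuple g (b j)) X))"
    and j: "j < d"
  obtains y where "(\<Sum>k<g. b j k * y k) > 1" "\<And>i. i < d \<Longrightarrow> i \<noteq> j \<Longrightarrow> (\<Sum>k<g. b i k * y k) \<le> 1"
proof -
  define js where "js = filter (\<lambda>i. i \<noteq> j) [0..<d]"
  define C where "C = tuple_direct_sum g (map (\<lambda>i. scalar_tuple g (b i)) js)"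
  have setjs: "set js = {..<d} - {j}" by (auto simp: js_def)
  have len: "length js = d - 1"
    using distinct_card[of js] j unfolding setjs by (simp add: js_def)
  have sum: "(\<Sum>i\<leftarrow>js. 1) = d - 1" by (simp add: sum_list_triv len)
  have C: "C \<in> sym_tuples g (d - 1)"
    using tuple_direct_sum_sym[of js "\<lambda>i. scalar_tuple g (b i)" g "\<lambda>_. 1", OF scalar_tuple_sym]
    unfolding sum C_def .
  have psdC: "psd_mat (lin_pencil (d - 1) n C X) \<longleftrightarrow>
      (\<forall>i<d. i \<noteq> j \<longrightarrow> psd_mat (lin_pencil 1 n (scalar_tuple g (b i)) X))" if X: "X \<in> sym_tuples g n" for n X
    using psd_lin_pencil_direct_sum[of js "\<lambda>i. scalar_tuple g (b i)" g "\<lambda>_. 1" X n, OF scalar_tuple_sym X, unfolded sum]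
    by (auto simp: C_def setjs)
  have "free_spectrahedron g (d - 1) C \<noteq> free_spectrahedron g d A"
  proof
    assume "free_spectrahedron g (d - 1) C = free_spectrahedron g d A"
    moreover have "d - 1 \<ge> 1" using d by simp
    ultimately have "d \<le> d - 1" using min C unfolding minimal_defining_tuple_def by blast
    then show False using d by simp
  qed
  moreover have memb: "X \<in> free_spectrahedron g e M \<Longrightarrow> \<exists>n\<ge>1. X \<in> sym_tuples g n" for X e M
    by (auto simp: free_spectrahedron_def spectrahedron_level_def)
  ultimately obtain n X where n: "n \<ge> 1" and X: "X \<in> sym_tuples g n"
    and "X \<in> free_spectrahedron g (d - 1) C \<longleftrightarrow> X \<notin> free_spectrahedron g d A" by blast
  then have ne: "psd_mat (lin_pencil (d - 1) n C X) \<noteq> psd_mat (lin_pencil d n A X)"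
    using free_spectrahedron_iff[OF g X n] by blast
  then have nj: "\<not> psd_mat (lin_pencil 1 n (scalar_tuple g (b j)) X)"
    and oth: "\<And>i. i < d \<Longrightarrow> i \<noteq> j \<Longrightarrow> psd_mat (lin_pencil 1 n (scalar_tuple g (b i)) X)"
    unfolding psdC[OF X] half[OF n X] using j by blast+
  obtain v where v: "v \<in> carrier_vec n"
    and neg: "v \<bullet> (lin_pencil 1 n (scalar_tuple g (b j)) X *\<^sub>v v) < 0"
    using nj unfolding psd_lin_pencil_iff[OF scalar_tuple_sym X] by force
  \<comment> \<open>The compression of \<open>X\<close> to the line spanned by \<open>v\<close>.\<close>
  define y where "y k = (v \<bullet> (X ! k *\<^sub>v v)) / (v \<bullet> v)" for k
  have vv: "v \<bullet> v > 0"
  proof -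
    have "v \<noteq> 0\<^sub>v n"
    proof
      assume v0: "v = 0\<^sub>v n"
      have "lin_pencil 1 n (scalar_tuple g (b j)) X *\<^sub>v v \<in> carrier_vec n"
        using lin_pencil_sym_carrier[OF scalar_tuple_sym X, of "b j"] v by simp
      then show False using neg v0 by simp
    qed
    then show ?thesis using scalar_prod_self_eq_0_iff[OF v] scalar_prod_self_nonneg[of v] by linarith
  qed
  have form: "v \<bullet> (lin_pencil 1 n (scalar_tuple g c) X *\<^sub>v v) = (v \<bullet> v) * (1 - (\<Sum>k<g. c k * y k))" for c
    unfolding quadratic_form_lin_pencil_scalar_left[OF X v] using vv
    by (simp add: y_def sum_distrib_left right_diff_distrib)
  show thesis
  proof (rule that)
    show "(\<Sum>k<g. b j k * y k) > 1" using neg vv unfolding form by (simp add: mult_less_0_iff)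
    fix i assume "i < d" "i \<noteq> j"
    then have "v \<bullet> (lin_pencil 1 n (scalar_tuple g (b i)) X *\<^sub>v v) \<ge> 0"
      using oth v unfolding psd_lin_pencil_iff[OF scalar_tuple_sym X] by simp
    then show "(\<Sum>k<g. b i k * y k) \<le> 1" using vv unfolding form by (simp add: zero_le_mult_iff)
  qed
qed

text \<open>
  A special case of the uniqueness of minimal defining tuples up to unitary equivalence.
\<close>

theorem minimal_free_polytope_diagonal:
  assumes g: "g \<ge> 1" and d: "d \<ge> 2" and min: "minimal_defining_tuple g d A"
    and poly: "free_polytope g (free_spectrahedron g d A)"
  obtains b where "unitarily_equivalent d A (tuple_direct_sum g (map (\<lambda>j. scalar_tuple g (b j)) [0..<d]))"
proof -
  have A: "A \<in> sym_tuples g d" using min by (simp add: minimal_defining_tuple_def)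
  have d1: "d \<ge> 1" using d by simp
  obtain b where half: "\<And>n X. n \<ge> 1 \<Longrightarrow> X \<in> sym_tuples g n \<Longrightarrow>
    psd_mat (lin_pencil d n A X) \<longleftrightarrow> (\<forall>j<d. psd_mat (lin_pencil 1 n (scalar_tuple g (b j)) X))"
    using free_polytope_halfspaces[OF g d1 min poly] by blast
  have polytope: "psd_mat (lin_pencil d 1 A (scalar_tuple g x)) \<longleftrightarrow> (\<forall>i<d. (\<Sum>k<g. b i k * x k) \<le> 1)" for x
    using half[OF order_refl scalar_tuple_sym] by (simp only: psd_lin_pencil_scalar_scalar)
  have "\<exists>y. (\<Sum>k<g. b j k * y k) > 1 \<and> (\<forall>i<d. i \<noteq> j \<longrightarrow> (\<Sum>k<g. b i k * y k) \<le> 1)" if "j < d" for j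
    by (rule minimal_halfspace_irredundant[OF g d min half that]) blast+
  then obtain y where yj: "\<And>j. j < d \<Longrightarrow> (\<Sum>k<g. b j k * y j k) > 1"
    and yi: "\<And>i j. j < d \<Longrightarrow> i < d \<Longrightarrow> i \<noteq> j \<Longrightarrow> (\<Sum>k<g. b i k * y j k) \<le> 1"
    by metis
  have "\<exists>v. v \<in> carrier_vec d \<and> v \<noteq> 0\<^sub>v d \<and> (\<forall>k<g. A ! k *\<^sub>v v = b j k \<cdot>\<^sub>v v)" if j: "j < d" for j
    by (rule facet_normal_joint_eigenvalue[OF A polytope j yj[OF j] yi[OF j]]) blast+
  then obtain v where v: "\<And>j. j < d \<Longrightarrow> v j \<in> carrier_vec d \<and> v j \<noteq> 0\<^sub>v d \<and> (\<forall>k<g. A ! k *\<^sub>v v j = b j k \<cdot>\<^sub>v v j)"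
    by metis
  have distinct: "\<exists>k<g. b i k \<noteq> b j k" if ij: "i < d" "j < d" "i \<noteq> j" for i j
  proof (rule ccontr)
    assume "\<not> ?thesis"
    then have "(\<Sum>k<g. b i k * y j k) = (\<Sum>k<g. b j k * y j k)" by (intro sum.cong) auto
    then show False using yj[OF ij(2)] yi[OF ij(2,1,3)] by simp
  qed
  show thesis by (rule that[OF joint_eigenbasis_unitarily_equivalent[OF A v distinct]])
qed

section \<open>Kernel bounds for Arveson extreme points\<close>

lemma arveson_kernel_bound_pencil:
  assumes A: "A \<in> sym_tuples g d" and arv: "arveson_extreme_point g d A n X"
  shows "g * n \<le> d * kernel_dim (lin_pencil d n A X)"
proof -
  have "map (\<lambda>M. (1\<^sub>m d)\<^sup>T * M * 1\<^sub>m d) A = A"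
    using sym_tuplesD(4)[OF A] by (intro map_idI) auto
  moreover have "tuple_direct_sum g (map (\<lambda>_. A) [0::nat]) = A"
    using sym_tuplesD(1)[OF A] by (intro nth_equalityI) (simp_all add: tuple_direct_sum_def del: diag_block_mat.simps)
  ultimately have "unitarily_equivalent d A (tuple_direct_sum g (map (\<lambda>_. A) [0::nat]))"
    unfolding unitarily_equivalent_def by (intro bexI[of _ "1\<^sub>m d"]) auto
  from arveson_extreme_point_kernel_bound[of A g d "[0::nat]" "\<lambda>_. A" "\<lambda>_. d", OF A A this arv]
  show ?thesis by simp
qed

text \<open>
  For \<open>d = 1\<close> the general bound already has the required form, so the diagonalization is only
  needed for \<open>d \<ge> 2\<close>, where one half-space can be omitted.
\<close>

lemma arveson_kernel_bound_free_polytope: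
  assumes g: "g \<ge> 1" and d: "d \<ge> 1" and min: "minimal_defining_tuple g d A"
    and poly: "free_polytope g (free_spectrahedron g d A)" and arv: "arveson_extreme_point g d A n X"
  shows "g * n \<le> kernel_dim (lin_pencil d n A X)"
proof (cases "d = 1")
  case True
  have "A \<in> sym_tuples g d" using min by (simp add: minimal_defining_tuple_def)
  from arveson_kernel_bound_pencil[OF this arv] show ?thesis by (simp add: True)
next
  case False
  then have d2: "d \<ge> 2" using d by simp
  have A: "A \<in> sym_tuples g d" using min by (simp add: minimal_defining_tuple_def)
  have X: "X \<in> sym_tuples g n" using arv by (auto simp: arveson_extreme_point_def spectrahedron_level_def)
  obtain b where eq: "unitarily_equivalent d A (tuple_direct_sum g (map (\<lambda>j. scalar_tuple g (b j)) [0..<d]))"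
    using minimal_free_polytope_diagonal[OF g d2 min poly] by blast
  have sum: "(\<Sum>j\<leftarrow>[0..<d]. 1) = d" by (simp add: sum_list_triv)
  have "g * n \<le> (\<Sum>j\<leftarrow>[0..<d]. kernel_dim (lin_pencil 1 n (scalar_tuple g (b j)) X))"
    using arveson_extreme_point_kernel_bound[of A g d "[0..<d]" "\<lambda>j. scalar_tuple g (b j)" "\<lambda>_. 1" n X,
        OF A scalar_tuple_sym eq arv] by simp
  also have "\<dots> = kernel_dim (lin_pencil d n (tuple_direct_sum g (map (\<lambda>j. scalar_tuple g (b j)) [0..<d])) X)"
    using kernel_dim_lin_pencil_direct_sum[of "[0..<d]" "\<lambda>j. scalar_tuple g (b j)" g "\<lambda>_. 1" X n,
        OF scalar_tuple_sym X, unfolded sum] by simp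
  also have "\<dots> = kernel_dim (lin_pencil d n A X)"
    by (rule unitarily_equivalent_lin_pencil(2)[OF eq A X])
  finally show ?thesis .
qed

theorem theorem2p3:
  fixes g d n :: nat and A X :: "real mat list"
  assumes "g \<ge> 1" and "d \<ge> 1" and "n \<ge> 1"
    and "A \<in> sym_tuples g d"
    and "minimal_defining_tuple g d A"
    and "X \<in> spectrahedron_level g d A n"
  shows
    "(arveson_extreme_point g d A n X \<longrightarrow> g * n \<le> d * kernel_dim (lin_pencil d n A X)) \<and>
     (free_polytope g (free_spectrahedron g d A) \<and> arveson_extreme_point g d A n X \<longrightarrow>
        g * n \<le> kernel_dim (lin_pencil d n A X)) \<and>
     (\<forall>(l :: nat) (dj :: nat \<Rightarrow> nat) (Aj :: nat \<Rightarrow> real mat list).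
        (\<forall>j\<in>{1..l}. dj j \<ge> 1 \<and> Aj j \<in> sym_tuples g (dj j)) \<longrightarrow>
        unitarily_equivalent d A (tuple_direct_sum g (map Aj [1..<Suc l])) \<longrightarrow>
        arveson_extreme_point g d A n X \<longrightarrow>
        g * n \<le> (\<Sum>j = 1..l. dj j * kernel_dim (lin_pencil (dj j) n (Aj j) X)))"
proof (intro conjI impI allI)
  show "g * n \<le> d * kernel_dim (lin_pencil d n A X)" if "arveson_extreme_point g d A n X"
    by (rule arveson_kernel_bound_pencil[OF assms(4) that])
  show "g * n \<le> kernel_dim (lin_pencil d n A X)"
    if "free_polytope g (free_spectrahedron g d A) \<and> arveson_extreme_point g d A n X"
    using arveson_kernel_bound_free_polytope[OF assms(1,2,5)] that by blast
  fix l and dj :: "nat \<Rightarrow> nat" and Aj :: "nat \<Rightarrow> real mat list"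
  assume Aj: "\<forall>j\<in>{1..l}. dj j \<ge> 1 \<and> Aj j \<in> sym_tuples g (dj j)"
    and eq: "unitarily_equivalent d A (tuple_direct_sum g (map Aj [1..<Suc l]))"
    and arv: "arveson_extreme_point g d A n X"
  have "Aj j \<in> sym_tuples g (dj j)" if "j \<in> set [1..<Suc l]" for j using Aj that by auto
  from arveson_extreme_point_kernel_bound[OF assms(4) this eq arv]
  have "g * n \<le> (\<Sum>j\<leftarrow>[1..<Suc l]. dj j * kernel_dim (lin_pencil (dj j) n (Aj j) X))" .
  also have "\<dots> = (\<Sum>j = 1..l. dj j * kernel_dim (lin_pencil (dj j) n (Aj j) X))"
    by (simp add: sum_list_distinct_conv_sum_set atLeastLessThanSuc_atLeastAtMost del: upt_Suc)
  finally show "g * n \<le> (\<Sum>j = 1..l. dj j * kernel_dim (lin_pencil (dj j) n (Aj j) X))" .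
qed

end
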